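(* Let $n\geq 12$. Define the following trees on $n$ vertices: - $T^1_n$: a vertex $c$ adjacent to $n-3$ leaves and to one further vertex $u$, where $u$ is adjacent to exactly one other vertex, which is a leaf (i.e., the star $S_{n-1}$ with a pendant vertex attached to one of its leaves; $c$ has degree $n-2$); - $T^2_n$: a vertex $c$ adjacent to $n-4$ leaves and to the first vertex of a path $u\,w\,z$ (edges $cu,uw,wz$, with $z$ a leaf); $c$ has degree $n-3$; - $T^3_n$: a vertex $c$ adjacent to $n-4$ leaves and to one further vertex $u$, where $u$ is adjacent to exactly two other vertices, both leaves; $c$ has degree $n-3$; - $T^4_n$: a vertex $c$ adjacent to $n-5$ leaves and to two further vertices $u_1,u_2$, where each $u_i$ is adjacent to exactly one other vertex, which is a leaf; $c$ has degree $n-3$. Let $S_n$ be the star on $n$ vertices. Then for every tree $T$ on $n$ vertices not isomorphic to any of $S_n,T^1_n,T^2_n,T^3_n,T^4_n$, $$\eta_1(T)<\eta_1(T^4_n)<\eta_1(T^3_n)<\eta_1(T^2_n)<\eta_1(T^1_n)<\eta_1(S_n).$$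
   Context: For a simple graph $G$ with vertex set $\{v_1,\dots,v_n\}$ and no isolated vertices, let $d_i$ denote the degree of $v_i$. The extended adjacency matrix $A_{ex}(G)=(a^{ex}_{ij})$ is the $n\times n$ matrix with $a^{ex}_{ij}=\frac12\left(\frac{d_i}{d_j}+\frac{d_j}{d_i}\right)$ if $v_iv_j$ is an edge of $G$ and $a^{ex}_{ij}=0$ otherwise. The extended spectral radius $\eta_1(G)$ is the largest eigenvalue of $A_{ex}(G)$. *)

theory Defs
  imports "Graph_Theory.Graph_Theory" "Jordan_Normal_Form.Char_Poly"
begin

text \<open>
  Finite simple graphs are modelled as in \<open>Graph_Theory\<close>: \<open>pair_graph G\<close> says that \<open>G\<close> is a
  finite, symmetric, loop-free pair digraph, so an edge \<open>uv\<close> is the pair of arcs \<open>(u,v)\<close>, \<open>(v,u)\<close>.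
  The library constant \<open>tree\<close> is of no use for such graphs, because the walk \<open>u, v, u\<close> counts as
  a cycle there; a cycle of a simple graph has length at least 3.
\<close>

definition simple_tree :: "'a pair_pre_digraph \<Rightarrow> bool" where
  "simple_tree T \<longleftrightarrow>
     pair_graph T \<and> connected (with_proj T) \<and>
     \<not> (\<exists>p. pre_digraph.cycle (with_proj T) p \<and> 3 \<le> length p)"

abbreviation deg :: "'a pair_pre_digraph \<Rightarrow> 'a \<Rightarrow> real" where
  "deg G v \<equiv> real (out_degree (with_proj G) v)"

definition ext_adj :: "'a pair_pre_digraph \<Rightarrow> 'a \<Rightarrow> 'a \<Rightarrow> real" where
  "ext_adj G u v =
     (if (u, v) \<in> parcs G then (deg G u / deg G v + deg G v / deg G u) / 2 else 0)"

text \<open>The list \<open>vs\<close> is the enumeration \<open>v\<^sub>1, \<dots>, v\<^sub>n\<close> of the vertices.\<close>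

definition ext_adj_mat :: "'a pair_pre_digraph \<Rightarrow> 'a list \<Rightarrow> real mat" where
  "ext_adj_mat G vs = mat (length vs) (length vs) (\<lambda>(i, j). ext_adj G (vs ! i) (vs ! j))"

text \<open>
  By \<open>ext_spectral_radius_enum\<close> below, the value does not depend on the enumeration chosen.
\<close>

definition ext_spectral_radius :: "'a pair_pre_digraph \<Rightarrow> real" ("\<eta>\<^sub>1") where
  "\<eta>\<^sub>1 G = Max {k. eigenvalue (ext_adj_mat G (SOME vs. distinct vs \<and> set vs = pverts G)) k}"

definition graph_of_edges :: "'a set \<Rightarrow> ('a \<times> 'a) set \<Rightarrow> 'a pair_pre_digraph" where
  "graph_of_edges V E = \<lparr>pverts = V, parcs = E \<union> E\<inverse>\<rparr>"

text \<open>In all of the following trees on \<open>{0..<n}\<close> the vertex \<open>c\<close> is \<open>0\<close>.\<close>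

definition star :: "nat \<Rightarrow> nat pair_pre_digraph" where
  "star n = graph_of_edges {0..<n} ({0} \<times> {1..<n})"

text \<open>\<open>u = n - 2\<close>\<close>
definition T1 :: "nat \<Rightarrow> nat pair_pre_digraph" where
  "T1 n = graph_of_edges {0..<n} ({0} \<times> {1..n - 2} \<union> {(n - 2, n - 1)})"

text \<open>\<open>u = n - 3\<close>, \<open>w = n - 2\<close>, \<open>z = n - 1\<close>\<close>
definition T2 :: "nat \<Rightarrow> nat pair_pre_digraph" where
  "T2 n = graph_of_edges {0..<n} ({0} \<times> {1..n - 3} \<union> {(n - 3, n - 2), (n - 2, n - 1)})"

text \<open>\<open>u = n - 3\<close>\<close>
definition T3 :: "nat \<Rightarrow> nat pair_pre_digraph" where
  "T3 n = graph_of_edges {0..<n} ({0} \<times> {1..n - 3} \<union> {(n - 3, n - 2), (n - 3, n - 1)})"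

text \<open>\<open>u\<^sub>1 = n - 4\<close>, \<open>u\<^sub>2 = n - 3\<close>\<close>
definition T4 :: "nat \<Rightarrow> nat pair_pre_digraph" where
  "T4 n = graph_of_edges {0..<n} ({0} \<times> {1..n - 3} \<union> {(n - 4, n - 2), (n - 3, n - 1)})"

lemma eigenvalue_ext_adj_mat_iff:
  assumes vs: "distinct vs" "set vs = pverts G"
  shows "eigenvalue (ext_adj_mat G vs) k \<longleftrightarrow>
    (\<exists>x. (\<exists>u\<in>pverts G. x u \<noteq> 0) \<and>
         (\<forall>u\<in>pverts G. (\<Sum>w\<in>pverts G. ext_adj G u w * x w) = k * x u))"
    (is "?L \<longleftrightarrow> ?R")
proof -
  let ?n = "length vs"
  have bij: "bij_betw ((!) vs) {0..<?n} (pverts G)"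
    using bij_betw_nth[of vs "{0..<?n}" "pverts G"] vs by (simp add: atLeast0LessThan)
  have row: "row (ext_adj_mat G vs) i \<bullet> v = (\<Sum>j = 0..<?n. ext_adj G (vs ! i) (vs ! j) * v $ j)"
    if "i < ?n" "dim_vec v = ?n" for i v
    using that by (simp add: scalar_prod_def ext_adj_mat_def)
  have sum: "(\<Sum>w\<in>pverts G. f w) = (\<Sum>j = 0..<?n. f (vs ! j))" for f :: "'a \<Rightarrow> real"
    using sum.reindex_bij_betw[OF bij, of f] by simp
  have dim: "dim_row (ext_adj_mat G vs) = ?n" "dim_col (ext_adj_mat G vs) = ?n"
    by (simp_all add: ext_adj_mat_def)
  show ?thesis
  proof
    assume ?L
    then obtain v where v: "dim_vec v = ?n" "v \<noteq> 0\<^sub>v ?n"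
      "ext_adj_mat G vs *\<^sub>v v = k \<cdot>\<^sub>v v"
      unfolding eigenvalue_def eigenvector_def dim using carrier_vecD by blast
    define x where "x = (\<lambda>u. v $ the_inv_into {0..<?n} ((!) vs) u)"
    have x: "x (vs ! i) = v $ i" if "i < ?n" for i
      using that bij by (simp add: x_def the_inv_into_f_f bij_betw_def)
    from v(1,2) obtain i where i: "i < ?n" "v $ i \<noteq> 0"
      by (metis eq_vecI index_zero_vec)
    have "(\<Sum>w\<in>pverts G. ext_adj G u w * x w) = k * x u" if "u \<in> pverts G" for u
    proof -
      from that vs obtain i where i: "i < ?n" "u = vs ! i" by (metis in_set_conv_nth)
      have "(ext_adj_mat G vs *\<^sub>v v) $ i = k * v $ i" using v i by simp
      moreover have "(ext_adj_mat G vs *\<^sub>v v) $ i = row (ext_adj_mat G vs) i \<bullet> v"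
        using i by (simp add: dim)
      ultimately show ?thesis using i v row[of i v] by (simp add: sum x)
    qed
    moreover have "vs ! i \<in> pverts G" "x (vs ! i) \<noteq> 0" using i x vs by auto
    ultimately show ?R by blast
  next
    assume ?R
    then obtain x u where x: "u \<in> pverts G" "x u \<noteq> 0"
      "\<And>u. u \<in> pverts G \<Longrightarrow> (\<Sum>w\<in>pverts G. ext_adj G u w * x w) = k * x u" by blast
    define v where "v = vec ?n (\<lambda>i. x (vs ! i))"
    from x vs obtain i where i: "i < ?n" "u = vs ! i" by (metis in_set_conv_nth)
    have "v \<noteq> 0\<^sub>v ?n"
    proof
      assume "v = 0\<^sub>v ?n"
      then have "v $ i = 0" using i by simp
      then show False using i x by (simp add: v_def)
    qed
    moreover have "ext_adj_mat G vs *\<^sub>v v = k \<cdot>\<^sub>v v"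
    proof (rule eq_vecI)
      fix i assume "i < dim_vec (k \<cdot>\<^sub>v v)"
      then have i: "i < ?n" by (simp add: v_def)
      then have "(ext_adj_mat G vs *\<^sub>v v) $ i = row (ext_adj_mat G vs) i \<bullet> v"
        by (simp add: dim)
      also have "\<dots> = (\<Sum>j = 0..<?n. ext_adj G (vs ! i) (vs ! j) * v $ j)"
        using row[of i v] i by (simp add: v_def)
      also have "\<dots> = (\<Sum>w\<in>pverts G. ext_adj G (vs ! i) w * x w)"
        by (simp add: sum v_def)
      also have "\<dots> = k * x (vs ! i)" 
        using x(3)[of "vs ! i"] nth_mem[OF i] vs(2) by simp
      finally show "(ext_adj_mat G vs *\<^sub>v v) $ i = (k \<cdot>\<^sub>v v) $ i" using i by (simp add: v_def)
    qed (simp add: dim v_def)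
    moreover have "v \<in> carrier_vec ?n" by (simp add: v_def)
    ultimately show ?L unfolding eigenvalue_def eigenvector_def by (auto simp: dim)
  qed
qed

lemma ext_spectral_radius_enum:
  assumes "distinct vs" "set vs = pverts G"
  shows "\<eta>\<^sub>1 G = Max {k. eigenvalue (ext_adj_mat G vs) k}"
proof -
  define ws where "ws = (SOME vs. distinct vs \<and> set vs = pverts G)"
  have "distinct ws \<and> set ws = pverts G"
    unfolding ws_def by (rule someI[of _ vs]) (use assms in simp)
  then have "eigenvalue (ext_adj_mat G ws) = eigenvalue (ext_adj_mat G vs)"
    using eigenvalue_ext_adj_mat_iff[of ws G] eigenvalue_ext_adj_mat_iff[OF assms] by blast
  then show ?thesis
    unfolding ext_spectral_radius_def ws_def[symmetric] by simp
qed

lemma pair_graph_graph_of_edges: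
  assumes "finite V" "E \<subseteq> V \<times> V" "\<And>v. (v, v) \<notin> E"
  shows "pair_graph (graph_of_edges V E)"
proof -
  have "finite E" using assms(1,2) finite_subset by blast
  then show ?thesis
    using assms
    by unfold_locales
      (auto simp: graph_of_edges_def symmetric_def arcs_ends_def arc_to_ends_def with_proj_def
        sym_def)
qed

lemma digraph_iso_pair_iff:
  assumes G: "pair_wf_digraph G" and H: "pair_wf_digraph H"
  shows "digraph_iso (with_proj G) (with_proj H) \<longleftrightarrow>
    (\<exists>f. bij_betw f (pverts G) (pverts H) \<and>
         (\<forall>u\<in>pverts G. \<forall>v\<in>pverts G. (u, v) \<in> parcs G \<longleftrightarrow> (f u, f v) \<in> parcs H))"
    (is "?L \<longleftrightarrow> ?R")
proof
  assume ?L
  then obtain h where h: "pre_digraph.digraph_isomorphism (with_proj G) h"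
    "with_proj H = app_iso h (with_proj G)" unfolding digraph_iso_def by blast
  let ?f = "iso_verts h"
  have eqs: "pverts H = ?f ` pverts G" "parcs H = iso_arcs h ` parcs G"
      "iso_tail h = fst" "iso_head h = snd"
    using h(2) by (auto simp: with_proj_def app_iso_def)
  have inj: "inj_on ?f (pverts G)"
    and arc: "\<And>a. a \<in> parcs G \<Longrightarrow> iso_arcs h a = (?f (fst a), ?f (snd a))"
    using h(1) eqs(3,4) unfolding pre_digraph.digraph_isomorphism_def
    by (auto simp: with_proj_def prod_eq_iff)
  have "(u, v) \<in> parcs G \<longleftrightarrow> (?f u, ?f v) \<in> parcs H"
    if uv: "u \<in> pverts G" "v \<in> pverts G" for u v
  proof
    assume "(u, v) \<in> parcs G"
    then show "(?f u, ?f v) \<in> parcs H" using arc eqs(2) by force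
  next
    assume "(?f u, ?f v) \<in> parcs H"
    then obtain a where a: "a \<in> parcs G" "(?f u, ?f v) = (?f (fst a), ?f (snd a))"
      using arc eqs(2) by auto
    moreover have "fst a \<in> pverts G" "snd a \<in> pverts G"
      using pair_wf_digraph.arc_fst_in_verts[OF G a(1)] pair_wf_digraph.arc_snd_in_verts[OF G a(1)]
      by simp_all
    ultimately have "a = (u, v)" using inj uv by (auto simp: inj_on_def prod_eq_iff)
    then show "(u, v) \<in> parcs G" using a by simp
  qed
  then show ?R using inj eqs(1) by (auto simp: bij_betw_def)
next
  assume ?R
  then obtain f where f: "inj_on f (pverts G)" "f ` pverts G = pverts H"
    and e: "\<And>u v. u \<in> pverts G \<Longrightarrow> v \<in> pverts G \<Longrightarrow>
      (u, v) \<in> parcs G \<longleftrightarrow> (f u, f v) \<in> parcs H"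
    by (auto simp: bij_betw_def)
  have Gv: "u \<in> pverts G" "v \<in> pverts G" if "(u, v) \<in> parcs G" for u v
    using G that by (force simp: pair_wf_digraph_def)+
  have Hv: "u \<in> pverts H" "v \<in> pverts H" if "(u, v) \<in> parcs H" for u v
    using H that by (force simp: pair_wf_digraph_def)+
  let ?h = "\<lparr>iso_verts = f, iso_arcs = map_prod f f, iso_head = snd, iso_tail = fst\<rparr>"
  have wf: "wf_digraph (with_proj G)"
    using Gv by unfold_locales (auto simp: with_proj_def)
  have inj: "inj_on (map_prod f f) (parcs G)"
    by (rule inj_on_subset[OF map_prod_inj_on[OF f(1) f(1)]]) (use Gv in auto)
  have "map_prod f f ` parcs G = parcs H"
  proof
    show "map_prod f f ` parcs G \<subseteq> parcs H"
    proof
      fix a assume "a \<in> map_prod f f ` parcs G"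
      then obtain u v where uv: "(u, v) \<in> parcs G" "a = (f u, f v)" by auto
      then show "a \<in> parcs H" using e[OF Gv[OF uv(1)]] by blast
    qed
    show "parcs H \<subseteq> map_prod f f ` parcs G"
    proof
      fix a assume a: "a \<in> parcs H"
      then have "fst a \<in> f ` pverts G" "snd a \<in> f ` pverts G"
        using Hv[of "fst a" "snd a"] f(2) by auto
      then obtain u v where uv: "u \<in> pverts G" "v \<in> pverts G" "fst a = f u" "snd a = f v"
        by auto
      then have "a = map_prod f f (u, v)" by (simp add: prod_eq_iff)
      moreover from this have "(u, v) \<in> parcs G" using e[OF uv(1,2)] a by simp
      ultimately show "a \<in> map_prod f f ` parcs G" by blast
    qed
  qed
  then have "with_proj H = app_iso ?h (with_proj G)"
    using f by (simp add: with_proj_def app_iso_def)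
  moreover have "pre_digraph.digraph_isomorphism (with_proj G) ?h"
    using wf f inj unfolding pre_digraph.digraph_isomorphism_def by (simp add: with_proj_def)
  ultimately show ?L unfolding digraph_iso_def by blast
qed

lemma
  assumes "4 < n"
  shows pair_graph_star: "pair_graph (star n)" and pair_graph_T1: "pair_graph (T1 n)"
    and pair_graph_T2: "pair_graph (T2 n)" and pair_graph_T3: "pair_graph (T3 n)"
    and pair_graph_T4: "pair_graph (T4 n)"
  unfolding star_def T1_def T2_def T3_def T4_def
  by (rule pair_graph_graph_of_edges; use assms in auto)+

end

theory Submission
  imports "HOL-Analysis.Function_Topology" "HOL-Analysis.Convex" "Jordan_Normal_Form.Spectral_Radius" Defs
begin

text \<open>
  All comparisons are made between bounds for \<open>4 \<eta>\<^sub>1\<^sup>2\<close>. From below, the Rayleigh quotient of the star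
  formed by the edges at a vertex \<open>c\<close> gives the sum of \<open>(d\<^sub>c/d\<^sub>w + d\<^sub>w/d\<^sub>c)\<^sup>2\<close> over the neighbours \<open>w\<close>
  of \<open>c\<close>. From above, a tree is bipartite, so \<open>2 \<eta>\<^sub>1\<^sup>2\<close> is at most the squared Frobenius norm of the
  matrix; this is at most half the sum of \<open>d\<^sup>3 + d\<close> over all vertices, and with degree sum \<open>2 (n - 1)\<close> and
  maximal degree at most \<open>n - 1 - j\<close> convexity makes the sum of cubes largest for one vertex of degree
  \<open>n - 1 - j\<close>, one of degree \<open>j + 1\<close> and otherwise leaves. This settles every comparison between trees
  of different maximal degree, and the trees of maximal degree at least \<open>n - 3\<close> are the five exceptions.
  The trees \<open>T\<^sup>2\<close>, \<open>T\<^sup>3\<close>, \<open>T\<^sup>4\<close> share the maximal degree \<open>n - 3\<close>; there \<open>T\<^sup>3\<close> and \<open>T\<^sup>4\<close> are bounded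
  from above by a positive vector \<open>y\<close> with \<open>A y \<le> k y\<close>, which loses less than the Frobenius norm.
\<close>

section \<open>Symmetric real matrices\<close>

text \<open>Tychonoff's theorem in the topology of the function type. Vectors indexed by a finite
  set are treated below as functions on a whole type, which may be infinite.\<close>

lemma compact_PiE_UNIV:
  fixes S :: "'a \<Rightarrow> real set"
  assumes "\<And>i. compact (S i)"
  shows "compact (PiE UNIV S)"
proof -
  have "compactin (product_topology (\<lambda>_. euclidean) UNIV) (PiE UNIV S)"
    using assms by (simp add: compactin_PiE)
  then show ?thesis by (simp add: euclidean_product_topology)
qed

text \<open>Compactness gives a maximiser on the unit sphere; both sides are homogeneous of degree
  two in \<open>y\<close>, so scaling extends the inequality to all \<open>y\<close>.\<close>

lemma rayleigh_max_attained:
  fixes b :: "'a \<Rightarrow> 'a \<Rightarrow> real"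
  assumes fin: "finite V" and ne: "V \<noteq> {}"
  obtains x where "(\<Sum>u\<in>V. (x u)\<^sup>2) = 1"
    and "\<And>y. (\<Sum>u\<in>V. \<Sum>w\<in>V. b u w * y u * y w)
              \<le> (\<Sum>u\<in>V. \<Sum>w\<in>V. b u w * x u * x w) * (\<Sum>u\<in>V. (y u)\<^sup>2)"
proof -
  define Q where "Q y = (\<Sum>u\<in>V. \<Sum>w\<in>V. b u w * y u * y w)" for y
  define N where "N y = (\<Sum>u\<in>V. (y u)\<^sup>2)" for y :: "'a \<Rightarrow> real"
  \<comment> \<open>Coordinates outside \<open>V\<close> are pinned to 0, which makes the sphere a
    closed subset of a product of compact sets.\<close>
  define K where "K = PiE UNIV (\<lambda>i. if i \<in> V then {-1..1} else {0::real}) \<inter> {y. N y = 1}"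
  have contN: "continuous_on UNIV N" and contQ: "continuous_on UNIV Q"
    unfolding N_def Q_def by (intro continuous_intros continuous_on_product_coordinates)+
  have "compact K"
    unfolding K_def
    by (intro compact_Int_closed compact_PiE_UNIV closed_Collect_eq contN continuous_intros) auto
  moreover obtain a where a: "a \<in> V" using ne by blast
  have "(\<lambda>i. if i = a then 1 else 0) \<in> K"
    using a fin by (auto simp: K_def N_def if_distrib[of "\<lambda>t. t\<^sup>2"] cong: if_cong)
  then have "K \<noteq> {}" by blast
  ultimately obtain x where x: "x \<in> K" "\<And>y. y \<in> K \<Longrightarrow> Q y \<le> Q x"
    using continuous_attains_sup[of K Q] contQ continuous_on_subset by blast
  have Q_le: "Q y \<le> Q x * N y" for y
  proof (cases "N y = 0")
    case True
    then have "y u = 0" if "u \<in> V" for u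
      using that fin by (simp add: N_def sum_nonneg_eq_0_iff)
    then have "Q y = 0" by (simp add: Q_def)
    then show ?thesis using True by simp
  next
    case False
    moreover have "N y \<ge> 0" by (simp add: N_def sum_nonneg)
    ultimately have pos: "N y > 0" by simp
    define s where "s = sqrt (N y)"
    have s: "s > 0" "s\<^sup>2 = N y" using pos by (simp_all add: s_def)
    define z where "z = (\<lambda>i. if i \<in> V then y i / s else 0)"
    have "N z = N y / s\<^sup>2"
      by (simp add: N_def z_def power_divide sum_divide_distrib)
    then have Nz: "N z = 1" using s pos by simp
    have z_le: "\<bar>z i\<bar> \<le> 1" if "i \<in> V" for i
    proof -
      have "(z i)\<^sup>2 \<le> N z"
        unfolding N_def by (rule member_le_sum) (use that fin in auto)
      then show ?thesis using Nz by (simp add: abs_square_le_1)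
    qed
    have "z i \<in> (if i \<in> V then {-1..1} else {0})" for i
    proof (cases "i \<in> V")
      case True
      then have "\<bar>z i\<bar> \<le> 1" by (rule z_le)
      then show ?thesis using True by (simp only: abs_le_iff) auto
    qed (simp add: z_def)
    then have "z \<in> K"
      using Nz unfolding K_def by auto
    then have "Q z \<le> Q x" by (rule x)
    moreover have "Q z = Q y / s\<^sup>2"
      by (simp add: Q_def z_def sum_divide_distrib power2_eq_square)
    ultimately show ?thesis using s pos by (simp add: field_simps)
  qed
  show ?thesis
    by (rule that[of x]) (use x(1) Q_le in \<open>auto simp: K_def N_def Q_def\<close>)
qed

text \<open>For small \<open>t\<close> the linear term dominates. This takes the place of the
  vanishing derivative at a maximum.\<close>

lemma linear_le_quadratic_imp_zero:
  fixes a c :: real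
  assumes "\<And>t. t * a \<le> t\<^sup>2 * c"
  shows "a = 0"
proof (rule ccontr)
  assume a: "a \<noteq> 0"
  \<comment> \<open>The test value is \<open>t = e * a\<close>: it has the sign of \<open>a\<close>,
    and \<open>e\<close> is small enough for \<open>e * c < 1\<close>.\<close>
  define e where "e = 1 / (\<bar>c\<bar> + 1)"
  have e: "e > 0" "e * c < 1"
    by (auto simp: e_def divide_simps)
  have "(e * a) * a \<le> (e * a)\<^sup>2 * c" by (rule assms)
  then have "a\<^sup>2 * (e * (1 - e * c)) \<le> 0" by (simp add: algebra_simps power2_eq_square)
  moreover have "a\<^sup>2 * (e * (1 - e * c)) > 0" using a e by simp
  ultimately show False by linarith
qed

text \<open>Perturbing a maximiser of the Rayleigh quotient in the single coordinate
  \<open>a\<close> forces the first-order term to vanish, which is row \<open>a\<close> of the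
  eigenvalue equation. The third property is what later identifies \<open>k\<close> as the largest
  eigenvalue.\<close>

lemma symmetric_top_eigenvector:
  fixes b :: "'a \<Rightarrow> 'a \<Rightarrow> real"
  assumes fin: "finite V" and ne: "V \<noteq> {}" and sym: "\<And>u w. b u w = b w u"
  obtains k x where "\<exists>u\<in>V. x u \<noteq> 0"
    and "\<And>u. u \<in> V \<Longrightarrow> (\<Sum>w\<in>V. b u w * x w) = k * x u"
    and "\<And>y. (\<Sum>u\<in>V. \<Sum>w\<in>V. b u w * y u * y w) \<le> k * (\<Sum>u\<in>V. (y u)\<^sup>2)"
proof -
  obtain x where x: "(\<Sum>u\<in>V. (x u)\<^sup>2) = 1"
    and max: "\<And>y. (\<Sum>u\<in>V. \<Sum>w\<in>V. b u w * y u * y w)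
              \<le> (\<Sum>u\<in>V. \<Sum>w\<in>V. b u w * x u * x w) * (\<Sum>u\<in>V. (y u)\<^sup>2)"
    using rayleigh_max_attained[OF fin ne, of b] by blast
  define k where "k = (\<Sum>u\<in>V. \<Sum>w\<in>V. b u w * x u * x w)"
  have "(\<Sum>w\<in>V. b a w * x w) = k * x a" if a: "a \<in> V" for a
  proof -
    let ?B = "\<Sum>w\<in>V. b a w * x w"
    \<comment> \<open>Maximality is applied to \<open>x\<close> plus \<open>t\<close> times the unit
      vector at \<open>a\<close>. The constant terms cancel, because at \<open>x\<close> the form
      has value \<open>k\<close> and the squared norm is 1; symmetry of \<open>b\<close> merges the
      two linear terms.\<close>
    have "t * (2 * (?B - k * x a)) \<le> t\<^sup>2 * (k - b a a)" for t
    proof -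
      define i where "i u = (if u = a then t else 0)" for u
      have s1: "(\<Sum>u\<in>V. f u * i u) = t * f a" "(\<Sum>u\<in>V. i u * f u) = t * f a" for f
        using a fin by (simp_all add: i_def if_distrib[of "\<lambda>t. _ * t"] if_distrib[of "\<lambda>t. t * _"]
            cong: if_cong)
      have "(\<Sum>u\<in>V. (x u + i u)\<^sup>2) = (\<Sum>u\<in>V. (x u)\<^sup>2) + (\<Sum>u\<in>V. i u * (2 * x u)) + (\<Sum>u\<in>V. i u * i u)"
        unfolding sum.distrib[symmetric] by (rule sum.cong) (auto simp: power2_eq_square algebra_simps)
      also have "\<dots> = 1 + t * (2 * x a) + t * i a" by (simp only: s1 x)
      finally have N: "(\<Sum>u\<in>V. (x u + i u)\<^sup>2) = 1 + 2 * t * x a + t\<^sup>2"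
        by (simp add: i_def power2_eq_square)
      have row: "(\<Sum>w\<in>V. b u w * (x w + i w)) = (\<Sum>w\<in>V. b u w * x w) + t * b u a" for u
        by (simp add: distrib_left sum.distrib s1)
      have "(\<Sum>u\<in>V. \<Sum>w\<in>V. b u w * (x u + i u) * (x w + i w))
          = (\<Sum>u\<in>V. (x u + i u) * (\<Sum>w\<in>V. b u w * (x w + i w)))"
        by (simp add: sum_distrib_left mult_ac)
      also have "\<dots> = (\<Sum>u\<in>V. x u * (\<Sum>w\<in>V. b u w * x w)) + t * (\<Sum>u\<in>V. b u a * x u)
          + (\<Sum>u\<in>V. i u * ((\<Sum>w\<in>V. b u w * x w) + t * b u a))"
        unfolding row sum_distrib_left[of t] sum.distrib[symmetric]
        by (rule sum.cong) (auto simp: algebra_simps)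
      also have "(\<Sum>u\<in>V. b u a * x u) = ?B"
        by (rule sum.cong) (simp_all only: sym[of _ a])
      also have "(\<Sum>u\<in>V. i u * ((\<Sum>w\<in>V. b u w * x w) + t * b u a)) = t * (?B + t * b a a)"
        by (rule s1)
      also have "(\<Sum>u\<in>V. x u * (\<Sum>w\<in>V. b u w * x w)) = k"
        by (simp add: k_def sum_distrib_left mult_ac)
      finally have "k + t * ?B + t * (?B + t * b a a) \<le> k * (1 + 2 * t * x a + t\<^sup>2)"
        using max[of "\<lambda>u. x u + i u"] unfolding N k_def[symmetric] by linarith
      then show ?thesis by (simp add: algebra_simps power2_eq_square)
    qed
    then have "2 * (?B - k * x a) = 0" by (rule linear_le_quadratic_imp_zero)
    then show ?thesis by simp
  qed
  moreover have "\<exists>u\<in>V. x u \<noteq> 0"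
  proof (rule ccontr)
    assume "\<not> ?thesis"
    then have "(\<Sum>u\<in>V. (x u)\<^sup>2) = 0" by simp
    then show False using x by simp
  qed
  ultimately show ?thesis using max that[of x k] by (simp add: k_def)
qed

section \<open>Bounds for the extended spectral radius\<close>

abbreviation nbrs :: "'a pair_pre_digraph \<Rightarrow> 'a \<Rightarrow> 'a set" where
  "nbrs G u \<equiv> parcs G `` {u}"

lemma out_degree_eq_card_nbrs: "out_degree (with_proj G) u = card (nbrs G u)"
proof -
  have "bij_betw (Pair u) (nbrs G u) (out_arcs (with_proj G) u)"
    by (auto simp: bij_betw_def inj_on_def out_arcs_def)
  then show ?thesis by (simp add: out_degree_def bij_betw_same_card)
qed

lemma ext_adj_nonneg: "0 \<le> ext_adj G u w"
  by (simp add: ext_adj_def)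

context pair_graph
begin

lemma arc_sym: "(u, w) \<in> parcs G \<Longrightarrow> (w, u) \<in> parcs G"
  using pair_sym_arcs by (auto simp: symmetric_def dest: symD)

lemma nbrs_subset: "nbrs G u \<subseteq> pverts G"
  by (auto dest: in_arcsD2)

lemma finite_nbrs: "finite (nbrs G u)"
  using nbrs_subset pair_finite_verts by (rule finite_subset)

lemma nbrs_irrefl: "u \<notin> nbrs G u"
  using pair_no_loops by force

lemma ext_adj_sym: "ext_adj G u w = ext_adj G w u"
  using arc_sym[of u w] arc_sym[of w u] by (auto simp: ext_adj_def add.commute)

lemma ext_adj_self: "ext_adj G u u = 0"
  using nbrs_irrefl by (auto simp: ext_adj_def)

lemma sum_arcs:
  fixes f :: "'a \<Rightarrow> real"
  shows "(\<Sum>w\<in>pverts G. if (u, w) \<in> parcs G then f w else 0) = (\<Sum>w\<in>nbrs G u. f w)"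
proof -
  have "nbrs G u = {w \<in> pverts G. (u, w) \<in> parcs G}" using nbrs_subset by auto
  then show ?thesis by (simp add: sum.inter_filter pair_finite_verts)
qed

lemma sum_ext_adj:
  "(\<Sum>w\<in>pverts G. ext_adj G u w * y w)
    = (\<Sum>w\<in>nbrs G u. (deg G u / deg G w + deg G w / deg G u) / 2 * y w)"
  unfolding sum_arcs[symmetric] by (rule sum.cong) (auto simp: ext_adj_def)

text \<open>Testing the Rayleigh inequality on an eigenvector bounds every eigenvalue by the maximum
  \<open>k\<close> of the quotient, and \<open>k\<close> is itself an eigenvalue; hence
  \<open>k\<close> is the \<open>Max\<close> that defines \<open>\<eta>\<^sub>1\<close>. Both facts
  come from this one identification.\<close>

lemma
  assumes ne: "pverts G \<noteq> {}"
  shows ext_spectral_radius_eigenvector: "\<exists>x. (\<exists>u\<in>pverts G. x u \<noteq> 0) \<and>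
      (\<forall>u\<in>pverts G. (\<Sum>w\<in>pverts G. ext_adj G u w * x w) = \<eta>\<^sub>1 G * x u)"
    and ext_spectral_radius_rayleigh: "(\<Sum>u\<in>pverts G. \<Sum>w\<in>pverts G. ext_adj G u w * y u * y w)
      \<le> \<eta>\<^sub>1 G * (\<Sum>u\<in>pverts G. (y u)\<^sup>2)"
proof -
  let ?V = "pverts G"
  obtain k x where x: "\<exists>u\<in>?V. x u \<noteq> 0"
    and eig: "\<And>u. u \<in> ?V \<Longrightarrow> (\<Sum>w\<in>?V. ext_adj G u w * x w) = k * x u"
    and ray: "\<And>y. (\<Sum>u\<in>?V. \<Sum>w\<in>?V. ext_adj G u w * y u * y w) \<le> k * (\<Sum>u\<in>?V. (y u)\<^sup>2)"
    by (rule symmetric_top_eigenvector[of ?V "ext_adj G"])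
      (use ne pair_finite_verts ext_adj_sym in auto)
  obtain vs where vs: "set vs = ?V" "distinct vs"
    using pair_finite_verts finite_distinct_list by blast
  let ?E = "{k. eigenvalue (ext_adj_mat G vs) k}"
  note ev = eigenvalue_ext_adj_mat_iff[OF vs(2,1)]
  have "k \<in> ?E" using x eig by (auto simp: ev)
  moreover have "k' \<le> k" if "k' \<in> ?E" for k'
  proof -
    from that obtain z where z: "\<exists>u\<in>?V. z u \<noteq> 0"
      "\<And>u. u \<in> ?V \<Longrightarrow> (\<Sum>w\<in>?V. ext_adj G u w * z w) = k' * z u"
      by (auto simp: ev)
    have "k' * (\<Sum>u\<in>?V. (z u)\<^sup>2) = (\<Sum>u\<in>?V. z u * (k' * z u))"
      by (simp add: sum_distrib_left power2_eq_square mult_ac)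
    also have "\<dots> = (\<Sum>u\<in>?V. z u * (\<Sum>w\<in>?V. ext_adj G u w * z w))"
      by (rule sum.cong) (simp_all add: z(2))
    also have "\<dots> = (\<Sum>u\<in>?V. \<Sum>w\<in>?V. ext_adj G u w * z u * z w)"
      by (simp add: sum_distrib_left mult_ac)
    also have "\<dots> \<le> k * (\<Sum>u\<in>?V. (z u)\<^sup>2)" by (rule ray)
    finally have "k' * (\<Sum>u\<in>?V. (z u)\<^sup>2) \<le> k * (\<Sum>u\<in>?V. (z u)\<^sup>2)" .
    moreover have "(\<Sum>u\<in>?V. (z u)\<^sup>2) > 0"
      using z(1) pair_finite_verts by (auto intro: sum_pos2)
    ultimately show ?thesis by simp
  qed
  moreover have "finite ?E"
    using card_finite_spectrum(1)[of "ext_adj_mat G vs" "length vs"]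
    by (simp add: spectrum_def ext_adj_mat_def)
  ultimately have "\<eta>\<^sub>1 G = k"
    unfolding ext_spectral_radius_enum[OF vs(2,1)] by (intro Max_eqI) auto
  then show "\<exists>x. (\<exists>u\<in>?V. x u \<noteq> 0) \<and>
      (\<forall>u\<in>?V. (\<Sum>w\<in>?V. ext_adj G u w * x w) = \<eta>\<^sub>1 G * x u)"
    and "(\<Sum>u\<in>?V. \<Sum>w\<in>?V. ext_adj G u w * y u * y w) \<le> \<eta>\<^sub>1 G * (\<Sum>u\<in>?V. (y u)\<^sup>2)"
    using x eig ray by (auto intro!: exI[of _ x])
qed

text \<open>The Rayleigh quotient of the top eigenvector of the star formed by the edges at \<open>c\<close>.\<close>

lemma ext_spectral_radius_ge_star:
  assumes c: "c \<in> pverts G"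
  shows "(\<Sum>w\<in>nbrs G c. (deg G c / deg G w + deg G w / deg G c)\<^sup>2) \<le> 4 * (\<eta>\<^sub>1 G)\<^sup>2"
    and "0 \<le> \<eta>\<^sub>1 G"
proof -
  let ?V = "pverts G" and ?a = "ext_adj G c"
  have ray: "(\<Sum>u\<in>?V. \<Sum>w\<in>?V. ext_adj G u w * y u * y w) \<le> \<eta>\<^sub>1 G * (\<Sum>u\<in>?V. (y u)\<^sup>2)" for y
    by (rule ext_spectral_radius_rayleigh) (use c in blast)
  define S where "S = (\<Sum>w\<in>?V. (?a w)\<^sup>2)"
  define s where "s = sqrt S"
  have S: "S \<ge> 0" unfolding S_def by (rule sum_nonneg) simp
  then have s: "s \<ge> 0" "s\<^sup>2 = S" by (auto simp: s_def)
  define y where "y u = (if u = c then s else ?a u)" for u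
  have y: "y c = s" "\<And>u. u \<noteq> c \<Longrightarrow> y u = ?a u" "\<And>u. y u \<ge> 0"
    using s ext_adj_nonneg by (auto simp: y_def)
  have S': "S = (\<Sum>w\<in>?V - {c}. (?a w)\<^sup>2)"
    using sum.remove[OF pair_finite_verts c, of "\<lambda>w. (?a w)\<^sup>2"] by (simp add: S_def ext_adj_self)
  have N: "(\<Sum>u\<in>?V. (y u)\<^sup>2) = 2 * S"
    using sum.remove[OF pair_finite_verts c, of "\<lambda>u. (y u)\<^sup>2"] s(2) S' by (simp add: y)
  have rowc: "(\<Sum>w\<in>?V. ?a w * y w) = S"
    unfolding S_def by (rule sum.cong) (auto simp: y_def ext_adj_self power2_eq_square)
  \<comment> \<open>Only the term at \<open>c\<close> is kept; the other terms of the row are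
    nonnegative.\<close>
  have row: "(\<Sum>w\<in>?V. ext_adj G u w * y w) \<ge> ?a u * s" for u
  proof -
    have "ext_adj G u c * y c \<le> (\<Sum>w\<in>?V. ext_adj G u w * y w)"
      by (rule member_le_sum[OF c]) (use pair_finite_verts in \<open>auto simp: ext_adj_nonneg y(3)\<close>)
    then show ?thesis by (simp only: y(1) ext_adj_sym[of u c])
  qed
  have "(\<Sum>u\<in>?V - {c}. y u * (?a u * s)) = s * S"
    unfolding S' sum_distrib_left by (rule sum.cong) (auto simp: y(2) power2_eq_square)
  then have "2 * s * S = s * S + (\<Sum>u\<in>?V - {c}. y u * (?a u * s))" by simp
  also have "\<dots> \<le> s * S + (\<Sum>u\<in>?V - {c}. y u * (\<Sum>w\<in>?V. ext_adj G u w * y w))"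
    by (intro add_left_mono sum_mono mult_left_mono row y)
  also have "\<dots> = (\<Sum>u\<in>?V. y u * (\<Sum>w\<in>?V. ext_adj G u w * y w))"
    using sum.remove[OF pair_finite_verts c, of "\<lambda>u. y u * (\<Sum>w\<in>?V. ext_adj G u w * y w)"]
    by (simp add: rowc y(1))
  also have "\<dots> = (\<Sum>u\<in>?V. \<Sum>w\<in>?V. ext_adj G u w * y u * y w)"
    by (simp add: sum_distrib_left mult_ac)
  also have "\<dots> \<le> \<eta>\<^sub>1 G * (2 * S)" using ray[of y] by (simp only: N)
  finally have le: "s * (2 * S) \<le> \<eta>\<^sub>1 G * (2 * S)" by simp
  \<comment> \<open>Cancelling \<open>2 * S\<close> needs \<open>S \<noteq> 0\<close>; for
    \<open>S = 0\<close> the bound on the square is trivial.\<close>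
  have "s \<le> \<eta>\<^sub>1 G \<or> S = 0" using le S by (cases "S = 0") auto
  moreover have "0 \<le> \<eta>\<^sub>1 G"
  proof -
    \<comment> \<open>The all-ones vector is the test vector for nonnegativity.\<close>
    have "(\<Sum>u\<in>?V. \<Sum>w\<in>?V. ext_adj G u w * 1 * 1) \<le> \<eta>\<^sub>1 G * (\<Sum>u\<in>?V. 1\<^sup>2)"
      by (rule ray)
    moreover have "0 \<le> (\<Sum>u\<in>?V. \<Sum>w\<in>?V. ext_adj G u w * 1 * 1)"
      by (intro sum_nonneg) (simp add: ext_adj_nonneg)
    ultimately have "0 \<le> \<eta>\<^sub>1 G * real (card ?V)" by simp
    moreover have "card ?V > 0" using c pair_finite_verts card_gt_0_iff by blast
    ultimately show ?thesis using c by (auto simp: zero_le_mult_iff)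
  qed
  ultimately have "S \<le> (\<eta>\<^sub>1 G)\<^sup>2"
    using s by (metis power2_nonneg_ge_1_iff power_mono zero_le_power2)
  moreover have "4 * S = (\<Sum>w\<in>nbrs G c. (deg G c / deg G w + deg G w / deg G c)\<^sup>2)"
    unfolding S_def sum_distrib_left sum_arcs[symmetric]
    by (rule sum.cong) (auto simp: ext_adj_def power_divide)
  ultimately show "(\<Sum>w\<in>nbrs G c. (deg G c / deg G w + deg G w / deg G c)\<^sup>2) \<le> 4 * (\<eta>\<^sub>1 G)\<^sup>2"
    by simp
  show "0 \<le> \<eta>\<^sub>1 G" by fact
qed

text \<open>
  The rank-two matrix \<open>x\<^sub>u x\<^sub>w (1 - \<sigma>\<^sub>u \<sigma>\<^sub>w)\<close>, where \<open>\<sigma>\<close> is the sign of the colour class, has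
  Frobenius norm at most \<open>\<surd>2 |x|\<^sup>2\<close>; this gains the factor 2 over the plain Frobenius bound.
\<close>

lemma ext_spectral_radius_bipartite_frobenius:
  fixes col :: "'a \<Rightarrow> bool"
  assumes ne: "pverts G \<noteq> {}"
    and col: "\<And>u w. (u, w) \<in> parcs G \<Longrightarrow> col u \<noteq> col w"
  shows "2 * (\<eta>\<^sub>1 G)\<^sup>2 \<le> (\<Sum>u\<in>pverts G. \<Sum>w\<in>pverts G. (ext_adj G u w)\<^sup>2)"
proof -
  let ?V = "pverts G" and ?a = "ext_adj G"
  obtain x where x: "\<exists>u\<in>?V. x u \<noteq> 0"
    and eig: "\<forall>u\<in>?V. (\<Sum>w\<in>?V. ?a u w * x w) = \<eta>\<^sub>1 G * x u"
    using ext_spectral_radius_eigenvector[OF ne] by (elim exE conjE) (rule that; assumption)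
  define N where "N = (\<Sum>u\<in>?V. (x u)\<^sup>2)"
  have N: "N > 0" unfolding N_def using x pair_finite_verts by (auto intro: sum_pos2)
  define \<sigma> :: "'a \<Rightarrow> real" where "\<sigma> u = (if col u then 1 else -1)" for u
  define M where "M u w = x u * x w * (1 - \<sigma> u * \<sigma> w)" for u w
  have "(\<Sum>u\<in>?V. \<Sum>w\<in>?V. ?a u w * M u w) = (\<Sum>u\<in>?V. 2 * x u * (\<Sum>w\<in>?V. ?a u w * x w))"
    unfolding sum_distrib_left
  proof (intro sum.cong refl)
    fix u w
    \<comment> \<open>On an arc the two signs differ, so the last factor of \<open>M u w\<close> is
      2; off the arcs \<open>ext_adj\<close> is 0.\<close>
    show "?a u w * M u w = 2 * x u * (?a u w * x w)"
      using col[of u w] by (cases "(u, w) \<in> parcs G") (auto simp: M_def \<sigma>_def ext_adj_def)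
  qed
  also have "\<dots> = (\<Sum>u\<in>?V. 2 * \<eta>\<^sub>1 G * (x u)\<^sup>2)"
    by (rule sum.cong) (simp_all add: eig power2_eq_square)
  also have "\<dots> = 2 * \<eta>\<^sub>1 G * N" by (simp add: N_def sum_distrib_left)
  finally have aM: "(\<Sum>(u, w)\<in>?V \<times> ?V. ?a u w * M u w) = 2 * \<eta>\<^sub>1 G * N"
    by (simp add: sum.cartesian_product)
  \<comment> \<open>For signs, \<open>(1 - \<sigma> u * \<sigma> w)\<^sup>2 = 2 - 2 * \<sigma> u *
    \<sigma> w\<close>. Both double sums then factor, and the subtracted one is twice a
    square.\<close>
  have "(\<Sum>u\<in>?V. \<Sum>w\<in>?V. (M u w)\<^sup>2)
      = (\<Sum>u\<in>?V. \<Sum>w\<in>?V. 2 * ((x u)\<^sup>2 * (x w)\<^sup>2) - 2 * ((\<sigma> u * (x u)\<^sup>2) * (\<sigma> w * (x w)\<^sup>2)))"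
    by (intro sum.cong refl) (auto simp: M_def \<sigma>_def power2_eq_square)
  also have "\<dots> = 2 * (N * N) - 2 * ((\<Sum>u\<in>?V. \<sigma> u * (x u)\<^sup>2) * (\<Sum>u\<in>?V. \<sigma> u * (x u)\<^sup>2))"
    by (simp only: sum_subtractf sum_distrib_left[symmetric] sum_distrib_right[symmetric] N_def)
  also have "\<dots> \<le> 2 * N\<^sup>2" by (simp add: power2_eq_square)
  finally have MM: "(\<Sum>(u, w)\<in>?V \<times> ?V. (M u w)\<^sup>2) \<le> 2 * N\<^sup>2"
    by (simp add: sum.cartesian_product)
  define S where "S = (\<Sum>(u, w)\<in>?V \<times> ?V. (?a u w)\<^sup>2)"
  have S: "S \<ge> 0" unfolding S_def by (rule sum_nonneg) auto
  have "(2 * \<eta>\<^sub>1 G * N)\<^sup>2 \<le> S * (\<Sum>(u, w)\<in>?V \<times> ?V. (M u w)\<^sup>2)"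
    using Cauchy_Schwarz_ineq_sum[of "\<lambda>(u, w). ?a u w" "\<lambda>(u, w). M u w" "?V \<times> ?V"] aM
    by (simp add: case_prod_unfold S_def)
  also have "\<dots> \<le> S * (2 * N\<^sup>2)" using MM S by (rule mult_left_mono)
  finally have "(2 * (\<eta>\<^sub>1 G)\<^sup>2) * (2 * N\<^sup>2) \<le> S * (2 * N\<^sup>2)"
    by (simp add: power2_eq_square mult_ac)
  then have "2 * (\<eta>\<^sub>1 G)\<^sup>2 \<le> S" using N by simp
  then show ?thesis by (simp add: S_def sum.cartesian_product)
qed

text \<open>On an edge, four times the squared entry is the sum of the two squared degree quotients
  plus 2, and each quotient is at most its numerator because degrees are at least 1. The bound is
  written with one term for each orientation, so swapping the sums merges them; each vertex then
  receives its degree times (degree squared plus 1).\<close>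

lemma ext_spectral_radius_bipartite_le:
  fixes col :: "'a \<Rightarrow> bool"
  assumes ne: "pverts G \<noteq> {}"
    and col: "\<And>u w. (u, w) \<in> parcs G \<Longrightarrow> col u \<noteq> col w"
  shows "4 * (\<eta>\<^sub>1 G)\<^sup>2 \<le> (\<Sum>u\<in>pverts G. (deg G u) ^ 3 + deg G u)"
proof -
  let ?V = "pverts G" and ?a = "ext_adj G" and ?d = "deg G"
  let ?i = "\<lambda>u w t. if (u, w) \<in> parcs G then t else (0::real)"
  have bound: "4 * (?a u w)\<^sup>2 \<le> ?i u w ((?d u)\<^sup>2 + 1) + ?i w u ((?d w)\<^sup>2 + 1)" for u w
  proof (cases "(u, w) \<in> parcs G")
    case True
    then have "nbrs G u \<noteq> {}" "nbrs G w \<noteq> {}" using arc_sym by auto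
    then have d: "?d u \<ge> 1" "?d w \<ge> 1"
      using finite_nbrs[of u] finite_nbrs[of w]
      by (simp_all add: out_degree_eq_card_nbrs Suc_le_eq card_gt_0_iff)
    have "4 * (?a u w)\<^sup>2 = (?d u / ?d w)\<^sup>2 + (?d w / ?d u)\<^sup>2 + 2"
      using True d by (simp add: ext_adj_def power2_eq_square field_simps)
    moreover have "?d u / ?d w \<le> ?d u" "?d w / ?d u \<le> ?d w"
      using d by (auto simp: divide_le_eq mult_le_cancel_left1)
    then have "(?d u / ?d w)\<^sup>2 \<le> (?d u)\<^sup>2" "(?d w / ?d u)\<^sup>2 \<le> (?d w)\<^sup>2"
      by (auto intro!: power_mono)
    ultimately show ?thesis using True arc_sym[OF True] by (simp only: if_True)
  qed (use arc_sym in \<open>auto simp: ext_adj_def\<close>)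
  have row: "(\<Sum>w\<in>?V. ?i u w ((?d u)\<^sup>2 + 1)) = (?d u) ^ 3 + ?d u" for u
    unfolding sum_arcs
    by (simp add: out_degree_eq_card_nbrs power2_eq_square power3_eq_cube algebra_simps)
  have "8 * (\<eta>\<^sub>1 G)\<^sup>2 \<le> (\<Sum>u\<in>?V. \<Sum>w\<in>?V. 4 * (?a u w)\<^sup>2)"
    using ext_spectral_radius_bipartite_frobenius[OF ne col]
    by (simp add: sum_distrib_left[symmetric])
  also have "\<dots> \<le> (\<Sum>u\<in>?V. \<Sum>w\<in>?V. ?i u w ((?d u)\<^sup>2 + 1) + ?i w u ((?d w)\<^sup>2 + 1))"
    by (intro sum_mono bound)
  also have "\<dots> = (\<Sum>u\<in>?V. \<Sum>w\<in>?V. ?i u w ((?d u)\<^sup>2 + 1)) + (\<Sum>u\<in>?V. \<Sum>w\<in>?V. ?i w u ((?d w)\<^sup>2 + 1))"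
    by (simp only: sum.distrib)
  also have "(\<Sum>u\<in>?V. \<Sum>w\<in>?V. ?i w u ((?d w)\<^sup>2 + 1)) = (\<Sum>u\<in>?V. \<Sum>w\<in>?V. ?i u w ((?d u)\<^sup>2 + 1))"
    by (rule sum.swap)
  finally show ?thesis unfolding row by simp
qed

text \<open>Collatz-Wielandt argument: at a vertex where the ratio of \<open>\<bar>x u\<bar>\<close>
  to \<open>y u\<close> is largest, the row of the eigenvalue equation is compared with the
  supervector inequality. Absolute values take care of the signs of the eigenvector.\<close>

lemma ext_spectral_radius_le_supervector:
  assumes ne: "pverts G \<noteq> {}"
    and pos: "\<And>u. u \<in> pverts G \<Longrightarrow> 0 < y u"
    and super: "\<And>u. u \<in> pverts G \<Longrightarrow> (\<Sum>w\<in>pverts G. ext_adj G u w * y w) \<le> k * y u"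
  shows "\<eta>\<^sub>1 G \<le> k"
proof -
  let ?V = "pverts G" and ?a = "ext_adj G"
  obtain x where x: "\<exists>u\<in>?V. x u \<noteq> 0"
    and eig: "\<forall>u\<in>?V. (\<Sum>w\<in>?V. ?a u w * x w) = \<eta>\<^sub>1 G * x u"
    using ext_spectral_radius_eigenvector[OF ne] by (elim exE conjE) (rule that; assumption)
  define m where "m = Max ((\<lambda>u. \<bar>x u\<bar> / y u) ` ?V)"
  have "m \<in> (\<lambda>u. \<bar>x u\<bar> / y u) ` ?V"
    unfolding m_def by (rule Max_in) (use ne pair_finite_verts in auto)
  then obtain a where a: "a \<in> ?V" "m = \<bar>x a\<bar> / y a" by blast
  have m: "\<bar>x u\<bar> \<le> m * y u" if "u \<in> ?V" for u
  proof -
    have "\<bar>x u\<bar> / y u \<le> m" unfolding m_def using that pair_finite_verts by (intro Max_ge) auto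
    then show ?thesis using pos[OF that] by (simp add: field_simps)
  qed
  have xa: "\<bar>x a\<bar> = m * y a" using a pos[OF a(1)] by simp
  obtain u where u: "u \<in> ?V" "x u \<noteq> 0" using x by blast
  have "0 < \<bar>x u\<bar>" using u by simp
  also have "\<dots> \<le> m * y u" using m u by simp
  finally have m0: "m > 0" using pos[OF u(1)] by (simp add: zero_less_mult_iff)
  have "\<eta>\<^sub>1 G * (m * y a) \<le> \<bar>\<eta>\<^sub>1 G * x a\<bar>"
    by (simp add: abs_mult xa[symmetric] mult_right_mono)
  also have "\<dots> \<le> (\<Sum>w\<in>?V. \<bar>?a a w * x w\<bar>)" unfolding eig[rule_format, OF a(1), symmetric] by (rule sum_abs)
  also have "\<dots> \<le> (\<Sum>w\<in>?V. ?a a w * (m * y w))"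
    by (intro sum_mono) (simp add: abs_mult ext_adj_nonneg m mult_left_mono)
  also have "\<dots> = m * (\<Sum>w\<in>?V. ?a a w * y w)" by (simp add: sum_distrib_left mult_ac)
  also have "\<dots> \<le> m * (k * y a)" using m0 super[OF a(1)] by simp
  finally have "\<eta>\<^sub>1 G * (m * y a) \<le> k * (m * y a)" by (simp add: mult_ac)
  then show ?thesis using m0 pos[OF a(1)] by simp
qed

end

section \<open>Neighbourhoods with only two degrees\<close>

context pair_graph
begin

text \<open>The star bound when the neighbours of \<open>c\<close> are leaves or have one common
  degree \<open>e\<close>, as is the case at the centre of each of the five extremal trees.\<close>

lemma ext_spectral_radius_ge_two_degrees:
  assumes c: "c \<in> pverts G" and nb: "nbrs G c = L \<union> U" "L \<inter> U = {}"
    and L: "\<And>l. l \<in> L \<Longrightarrow> card (nbrs G l) = 1" and U: "\<And>u. u \<in> U \<Longrightarrow> card (nbrs G u) = e"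
    and D: "D = real (card (nbrs G c))"
  shows "real (card L) * (D + 1 / D)\<^sup>2 + real (card U) * (D / real e + real e / D)\<^sup>2
    \<le> 4 * (\<eta>\<^sub>1 G)\<^sup>2"
proof -
  have fin: "finite L" "finite U" using finite_nbrs[of c] nb by auto
  have "(\<Sum>w\<in>nbrs G c. (deg G c / deg G w + deg G w / deg G c)\<^sup>2)
      = (\<Sum>w\<in>L. (D + 1 / D)\<^sup>2) + (\<Sum>w\<in>U. (D / real e + real e / D)\<^sup>2)"
    unfolding nb(1) sum.union_disjoint[OF fin nb(2)]
    by (intro arg_cong2[of _ _ _ _ "(+)"] sum.cong)
      (simp_all add: out_degree_eq_card_nbrs L U D)
  then show ?thesis using ext_spectral_radius_ge_star(1)[OF c] by simp
qed

text \<open>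
  The supervector solves the eigenvalue equation, with the bound as the value of \<open>4 \<lambda>\<^sup>2\<close>, at every vertex except \<open>c\<close>; the
  hypothesis \<open>le\<close> is what remains at \<open>c\<close>.
\<close>

lemma ext_spectral_radius_le_depth_two:
  fixes e :: nat and D :: real
  defines "a \<equiv> \<lambda>m. real m * (D + 1 / D)\<^sup>2"
    and "b \<equiv> \<lambda>m. real m * (D / real e + real e / D)\<^sup>2"
    and "t \<equiv> (real e - 1) * (real e + 1 / real e)\<^sup>2"
  assumes c: "c \<in> pverts G" and nb: "nbrs G c = L \<union> U" "L \<inter> U = {}" and e: "1 \<le> e"
    and L: "\<And>l. l \<in> L \<Longrightarrow> nbrs G l = {c}"
    and U: "\<And>u. u \<in> U \<Longrightarrow> card (nbrs G u) = e"
    and Z: "\<And>u z. u \<in> U \<Longrightarrow> z \<in> nbrs G u \<Longrightarrow> z \<noteq> c \<Longrightarrow> nbrs G z = {u}"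
    and V: "pverts G \<subseteq> {c} \<union> L \<union> U \<union> (\<Union>u\<in>U. nbrs G u)"
    and D: "D = real (card (nbrs G c))" "0 < D"
    and t: "t < a (card L)"
    and le: "t * (b (card U) + 1) \<le> a (card L) + b (card U) + 1"
  shows "4 * (\<eta>\<^sub>1 G)\<^sup>2 \<le> a (card L) + b (card U) + 1"
proof -
  define A where "A = a (card L)"
  define B where "B = b (card U)"
  define \<mu> where "\<mu> = A + B + 1"
  define k where "k = sqrt \<mu>"
  define W1 where "W1 = D + 1 / D"
  define W2 where "W2 = D / real e + real e / D"
  define W3 where "W3 = real e + 1 / real e"
  have W: "W1 > 0" "W2 > 0" "W3 > 0" using D e by (auto simp: W1_def W2_def W3_def intro!: add_pos_pos)
  have A: "A = real (card L) * W1\<^sup>2" and B: "B = real (card U) * W2\<^sup>2" and tW: "t = (real e - 1) * W3\<^sup>2"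
    by (simp_all add: A_def B_def a_def b_def t_def W1_def W2_def W3_def)
  have "B \<ge> 0" by (simp add: B)
  then have mu: "t < \<mu>" using t by (simp add: \<mu>_def A_def)
  have "t \<ge> 0" using e by (simp add: t_def)
  then have mu0: "\<mu> > 0" using mu by simp
  then have k: "k > 0" "k * k = \<mu>" by (simp_all add: k_def)
  have cU: "c \<in> nbrs G u" if "u \<in> U" for u using that nb arc_sym by auto
  have c_notin: "c \<notin> L" "c \<notin> U" using nb nbrs_irrefl[of c] by auto
  \<comment> \<open>The leaves below \<open>U\<close> have their only neighbour in \<open>U\<close>,
    not at \<open>c\<close>, so they lie outside both classes and \<open>y\<close> takes its last
    branch there.\<close>
  have z_notin: "z \<notin> L \<union> U" if "u \<in> U" "z \<in> nbrs G u" "z \<noteq> c" for u z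
    using Z[OF that] L[of z] cU[of z] that c_notin by auto
  have fin: "finite L" "finite U" using finite_nbrs[of c] nb by auto
  \<comment> \<open>The weights without the factor 1/2 have target eigenvalue \<open>k\<close> with
    \<open>k * k = \<mu>\<close>. Eliminating the leaves below \<open>U\<close> leaves the factor
    \<open>\<mu> - t\<close> at a vertex of \<open>U\<close>; scaling by it clears denominators, and
    \<open>t < \<mu>\<close> makes all entries positive.\<close>
  define y where "y v = (if v = c then k * (\<mu> - t) else if v \<in> L then W1 * (\<mu> - t)
    else if v \<in> U then W2 * \<mu> else W3 * W2 * k)" for v
  have yc: "y c = k * (\<mu> - t)" by (simp add: y_def)
  have yL: "y l = W1 * (\<mu> - t)" if "l \<in> L" for l using that c_notin by (auto simp: y_def)
  have yU: "y u = W2 * \<mu>" if "u \<in> U" for u using that c_notin nb(2) by (auto simp: y_def)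
  have yZ: "y z = W3 * W2 * k" if "u \<in> U" "z \<in> nbrs G u" "z \<noteq> c" for u z
    using z_notin[OF that] that(3) by (simp add: y_def)
  have dL: "deg G l = 1" if "l \<in> L" for l using L[OF that] by (simp add: out_degree_eq_card_nbrs)
  have dU: "deg G u = e" if "u \<in> U" for u using U[OF that] by (simp add: out_degree_eq_card_nbrs)
  have dZ: "deg G z = 1" if "u \<in> U" "z \<in> nbrs G u" "z \<noteq> c" for u z
    using Z[OF that] by (simp add: out_degree_eq_card_nbrs)
  have dc: "deg G c = D" by (simp add: out_degree_eq_card_nbrs D)
  let ?w = "\<lambda>u w. deg G u / deg G w + deg G w / deg G u"
  have "(\<Sum>w\<in>nbrs G v. ?w v w * y w) \<le> k * y v" if v: "v \<in> pverts G" for v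
  proof -
    consider "v = c" | "v \<in> L" | "v \<in> U" | u where "u \<in> U" "v \<in> nbrs G u" "v \<noteq> c"
      using V v by blast
    then show ?thesis
    proof cases
      case 1
      have "(\<Sum>w\<in>nbrs G c. ?w c w * y w) = (\<Sum>w\<in>L. W1 * (W1 * (\<mu> - t))) + (\<Sum>w\<in>U. W2 * (W2 * \<mu>))"
        unfolding nb(1) sum.union_disjoint[OF fin nb(2)]
        by (intro arg_cong2[of _ _ _ _ "(+)"] sum.cong)
          (simp_all add: dc dL dU yL yU W1_def W2_def)
      also have "\<dots> = A * (\<mu> - t) + B * \<mu>" by (simp add: A B power2_eq_square)
      \<comment> \<open>With \<open>\<mu> = A + B + 1\<close> the difference of the two sides is
        \<open>\<mu> - t * (B + 1)\<close>, which is nonnegative by \<open>le\<close>.\<close>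
      also have "\<dots> \<le> \<mu> * (\<mu> - t)"
        using le unfolding A_def[symmetric] B_def[symmetric] by (simp add: \<mu>_def algebra_simps)
      finally show ?thesis using 1 k by (simp add: yc mult.assoc[symmetric])
    next
      case 2
      then show ?thesis by (simp add: L yc yL dL dc W1_def add.commute)
    next
      case 3
      let ?Z = "nbrs G v - {c}"
      have card: "card ?Z = e - 1" using cU[OF 3] U[OF 3] finite_nbrs by (simp add: card_Diff_singleton)
      have "(\<Sum>w\<in>nbrs G v. ?w v w * y w) = ?w v c * y c + (\<Sum>w\<in>?Z. ?w v w * y w)"
        by (rule sum.remove[OF finite_nbrs cU[OF 3]])
      also have "(\<Sum>w\<in>?Z. ?w v w * y w) = (\<Sum>w\<in>?Z. W3 * (W3 * W2 * k))"
        by (rule sum.cong) (use 3 in \<open>auto simp: dU dZ yZ W3_def\<close>)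
      also have "\<dots> = t * W2 * k"
        using e by (simp add: card tW of_nat_diff power2_eq_square)
      also have "?w v c * y c = W2 * (k * (\<mu> - t))"
        using 3 by (simp add: dU dc yc W2_def add.commute)
      finally show ?thesis using 3 by (simp add: yU algebra_simps)
    next
      case (4 u)
      have "(\<Sum>w\<in>nbrs G v. ?w v w * y w) = W3 * (W2 * \<mu>)"
        using 4 by (simp add: Z[OF 4] dZ[OF 4] dU yU W3_def add.commute)
      also have "\<dots> = k * y v" by (simp add: yZ[OF 4] k(2)[symmetric])
      finally show ?thesis by simp
    qed
  qed
  note row = this
  \<comment> \<open>The rows above omit the factor 1/2 of \<open>ext_adj\<close>, so the eigenvalue
    bound is halved here.\<close>
  have "\<eta>\<^sub>1 G \<le> k / 2"
  proof (rule ext_spectral_radius_le_supervector)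
    show "pverts G \<noteq> {}" using c by blast
    show "0 < y u" for u using W k mu mu0 by (auto simp: y_def)
    show "(\<Sum>w\<in>pverts G. ext_adj G u w * y w) \<le> k / 2 * y u" if "u \<in> pverts G" for u
      using row[OF that] unfolding sum_ext_adj
      by (simp add: sum_divide_distrib[symmetric])
  qed
  then have "(\<eta>\<^sub>1 G)\<^sup>2 \<le> (k / 2)\<^sup>2"
    using ext_spectral_radius_ge_star(2)[OF c] by (rule power_mono)
  then show ?thesis
    using k by (simp add: power2_eq_square \<mu>_def A_def B_def)
qed

end

section \<open>Degree sums and the bound from the maximal degree\<close>

text \<open>Convexity in the form needed for degrees minus 1: the extreme configuration has one
  value \<open>a\<close>, one value \<open>j\<close> and zeros elsewhere. If no value exceeds
  \<open>j\<close>, weighting by \<open>h\<close> suffices; otherwise one large value is split off,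
  the rest is concentrated in a single value, and the two values are pushed apart.\<close>

lemma sum_cubes_squares_le:
  fixes f :: "'a \<Rightarrow> nat"
  assumes fin: "finite V" and le: "\<And>v. v \<in> V \<Longrightarrow> f v \<le> a" and s: "sum f V = a + j" and j: "j \<le> a"
  shows "(\<Sum>v\<in>V. f v ^ 3 + 3 * f v ^ 2) \<le> a ^ 3 + 3 * a ^ 2 + j ^ 3 + 3 * j ^ 2"
proof -
  \<comment> \<open>The summand is \<open>x * h x\<close> with \<open>h\<close> increasing, so
    values bounded by \<open>m\<close> contribute at most their sum times
    \<open>h m\<close>.\<close>
  define h where "h x = x ^ 2 + 3 * x" for x :: nat
  have h_mono: "h x \<le> h z" if "x \<le> z" for x z using that by (auto simp: h_def intro!: add_mono power_mono)
  have h: "x ^ 3 + 3 * x ^ 2 = x * h x" for x by (simp add: h_def algebra_simps power2_eq_square power3_eq_cube)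
  have weighted: "(\<Sum>v\<in>W. f v * h (f v)) \<le> sum f W * h m" if "\<And>v. v \<in> W \<Longrightarrow> f v \<le> m" for W m
    unfolding sum_distrib_right by (intro sum_mono mult_left_mono h_mono that) auto
  have "(\<Sum>v\<in>V. f v * h (f v)) \<le> a * h a + j * h j"
  proof (cases "\<forall>v\<in>V. f v \<le> j")
    case True
    then have "(\<Sum>v\<in>V. f v * h (f v)) \<le> (a + j) * h j" using weighted[of V j] s by simp
    also have "\<dots> \<le> a * h a + j * h j" using h_mono[OF j] by (simp add: add_mult_distrib)
    finally show ?thesis .
  next
    case False
    then obtain v where v: "v \<in> V" "j < f v" by auto
    define M where "M = f v"
    have M: "M \<le> a" "j \<le> M" using le v by (auto simp: M_def)
    then obtain t where t: "a = M + t" using le_Suc_ex by blast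
    have r: "sum f (V - {v}) = j + t"
      using sum.remove[OF fin v(1), of f] s t by (simp add: M_def)
    have "f w \<le> j + t" if "w \<in> V - {v}" for w
      unfolding r[symmetric] by (rule member_le_sum[OF that]) (use fin in auto)
    then have "(\<Sum>v\<in>V - {v}. f v * h (f v)) \<le> (j + t) * h (j + t)"
      using weighted[of "V - {v}" "j + t"] r by simp
    \<comment> \<open>The pairs \<open>M\<close>, \<open>j + t\<close> and \<open>a\<close>,
      \<open>j\<close> have the same sum, and the first pair lies between \<open>j\<close> and
      \<open>a\<close>. Substituting \<open>M = j + i\<close> below removes all
      subtractions.\<close>
    moreover have "M * h M + (j + t) * h (j + t) \<le> a * h a + j * h j"
    proof -
      obtain i where i: "M = j + i" using M(2) le_Suc_ex by blast
      show ?thesis unfolding h_def t i by (simp add: algebra_simps power2_eq_square)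
    qed
    ultimately show ?thesis
      using sum.remove[OF fin v(1), of "\<lambda>v. f v * h (f v)"] by (simp add: M_def)
  qed
  then show ?thesis using h by (simp add: h add.assoc)
qed

text \<open>A tree is given by a parent map \<open>p\<close>; the depth \<open>d\<close> certifies
  that iterating \<open>p\<close> ends in the root \<open>c\<close>, and its parity is the
  2-colouring for the bipartite bounds.\<close>

locale rooted_tree = pair_graph G for G :: "'a pair_pre_digraph" +
  fixes c :: 'a and p :: "'a \<Rightarrow> 'a" and d :: "'a \<Rightarrow> nat"
  assumes root: "c \<in> pverts G"
    and parent: "\<And>v. v \<in> pverts G \<Longrightarrow> v \<noteq> c \<Longrightarrow> p v \<in> pverts G"
    and depth: "\<And>v. v \<in> pverts G \<Longrightarrow> v \<noteq> c \<Longrightarrow> d v = Suc (d (p v))"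
    and arcs: "parcs G = (\<lambda>v. (v, p v)) ` (pverts G - {c}) \<union> (\<lambda>v. (p v, v)) ` (pverts G - {c})"
begin

text \<open>Each vertex other than the root contributes one arc to its parent and one back. The two
  families are disjoint, since two vertices cannot be each other's parent by depth.\<close>

lemma sum_degree: "(\<Sum>u\<in>pverts G. card (nbrs G u)) = 2 * (card (pverts G) - 1)"
proof -
  let ?W = "pverts G - {c}"
  have "(\<Sum>u\<in>pverts G. card (nbrs G u)) = card (Sigma (pverts G) (nbrs G))"
    using pair_finite_verts finite_nbrs by simp
  also have "Sigma (pverts G) (nbrs G) = parcs G" by (auto dest: in_arcsD1)
  also have "card (parcs G) = card ((\<lambda>v. (v, p v)) ` ?W) + card ((\<lambda>v. (p v, v)) ` ?W)"
    unfolding arcs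
  proof (rule card_Un_disjoint)
    have "p (p v) \<noteq> v" if "v \<in> ?W" "p v \<in> ?W" for v
      using depth[of v] depth[of "p v"] that by auto
    then show "(\<lambda>v. (v, p v)) ` ?W \<inter> (\<lambda>v. (p v, v)) ` ?W = {}" by fastforce
  qed (use pair_finite_verts in auto)
  also have "\<dots> = card ?W + card ?W"
    by (intro arg_cong2[of _ _ _ _ "(+)"] card_image) (auto simp: inj_on_def)
  finally show ?thesis using root by (simp add: card_Diff_singleton)
qed

text \<open>Climbing along \<open>p\<close> lowers the depth until a child of the root is
  met.\<close>

lemma exists_child:
  assumes "v \<in> pverts G" "v \<noteq> c"
  shows "\<exists>w\<in>pverts G. w \<noteq> c \<and> p w = c"
  using assms
proof (induction "d v" arbitrary: v)
  case 0
  then show ?case using depth by fastforce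
next
  case (Suc k)
  then show ?case using Suc.hyps(1)[of "p v"] parent[of v] depth[of v] by (cases "p v = c") auto
qed

lemma card_nbrs_pos:
  assumes "2 \<le> card (pverts G)" "v \<in> pverts G"
  shows "1 \<le> card (nbrs G v)"
proof -
  have "nbrs G v \<noteq> {}"
  proof (cases "v = c")
    case True
    have "\<not> pverts G \<subseteq> {c}" using assms(1) card_mono[of "{c}" "pverts G"] by auto
    then obtain w where "w \<in> pverts G" "w \<noteq> c" "p w = c" using exists_child by blast
    then show ?thesis using True arcs by auto
  qed (use assms arcs in auto)
  then show ?thesis using finite_nbrs by (simp add: Suc_le_eq card_gt_0_iff)
qed

text \<open>With \<open>f\<close> the degree minus 1, a degree cube plus degree is
  \<open>f^3 + 3 f^2 + 4 f + 2\<close>. The sum of the last two terms is fixed by the number of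
  vertices, and the first two are bounded by convexity. The value corresponds to degrees
  \<open>a + 1\<close> and \<open>j + 1\<close> and otherwise \<open>a + j\<close> leaves.\<close>

lemma ext_spectral_radius_le_max_degree:
  assumes n: "card (pverts G) = a + j + 2" and j: "j \<le> a"
    and deg: "\<And>v. v \<in> pverts G \<Longrightarrow> card (nbrs G v) \<le> a + 1"
  shows "4 * (\<eta>\<^sub>1 G)\<^sup>2 \<le> (real a + 1) ^ 3 + (real j + 1) ^ 3 + 3 * (real a + real j) + 2"
proof -
  let ?V = "pverts G"
  define f where "f v = card (nbrs G v) - 1" for v
  have f: "card (nbrs G v) = f v + 1" if "v \<in> ?V" for v
    using card_nbrs_pos[OF _ that] n by (simp add: f_def)
  have "sum f ?V + card ?V = (\<Sum>v\<in>?V. f v + 1)" by (simp add: sum.distrib del: One_nat_def)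
  also have "\<dots> = (\<Sum>v\<in>?V. card (nbrs G v))" by (rule sum.cong) (simp_all add: f)
  \<comment> \<open>The degree sum is \<open>2 * (n - 1)\<close> with \<open>n = a + j + 2\<close>
    vertices; subtracting 1 per vertex leaves \<open>n - 2 = a + j\<close>.\<close>
  finally have s: "sum f ?V = a + j" using sum_degree n by simp
  have cubes: "(\<Sum>v\<in>?V. f v ^ 3 + 3 * f v ^ 2) \<le> a ^ 3 + 3 * a ^ 2 + j ^ 3 + 3 * j ^ 2"
    by (rule sum_cubes_squares_le[OF pair_finite_verts _ s j]) (use deg f in fastforce)
  have "(even (d u)) \<noteq> even (d w)" if "(u, w) \<in> parcs G" for u w
    using that depth unfolding arcs by auto
  then have "4 * (\<eta>\<^sub>1 G)\<^sup>2 \<le> (\<Sum>u\<in>?V. (Defs.deg G u) ^ 3 + Defs.deg G u)"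
    using root by (intro ext_spectral_radius_bipartite_le[of "\<lambda>u. even (d u)"]) auto
  also have "\<dots> = (\<Sum>u\<in>?V. real (f u ^ 3 + 3 * f u ^ 2 + 4 * f u + 2))"
    by (rule sum.cong)
      (simp_all add: out_degree_eq_card_nbrs f algebra_simps power2_eq_square power3_eq_cube)
  also have "\<dots> = real ((\<Sum>v\<in>?V. f v ^ 3 + 3 * f v ^ 2) + 4 * sum f ?V + 2 * card ?V)"
    by (simp add: sum.distrib sum_distrib_left)
  also have "\<dots> \<le> real (a ^ 3 + 3 * a ^ 2 + j ^ 3 + 3 * j ^ 2 + 4 * (a + j) + 2 * (a + j + 2))"
    using cubes s n by (intro of_nat_mono) simp
  also have "\<dots> = (real a + 1) ^ 3 + (real j + 1) ^ 3 + 3 * (real a + real j) + 2"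
    by (simp add: algebra_simps power2_eq_square power3_eq_cube)
  finally show ?thesis .
qed

end

section \<open>Rooted trees and isomorphism\<close>

text \<open>A path from \<open>v\<close> back to \<open>u\<close> that avoids the edge closes up
  with the arc to a cycle. Its length is at least 3, because the only single arc from
  \<open>v\<close> to \<open>u\<close> was removed.\<close>

lemma no_path_around_arc:
  assumes T: "simple_tree T" and arc: "(u, v) \<in> parcs T"
  shows "\<not> v \<rightarrow>\<^sup>*\<^bsub>with_proj \<lparr>pverts = pverts T, parcs = parcs T - {(u, v), (v, u)}\<rparr>\<^esub> u"
proof
  let ?H = "\<lparr>pverts = pverts T, parcs = parcs T - {(u, v), (v, u)}\<rparr>"
  interpret T: pair_graph T using T by (simp add: simple_tree_def)
  interpret H: pair_wf_digraph ?H by unfold_locales (auto dest: T.in_arcsD1 T.in_arcsD2)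
  assume "v \<rightarrow>\<^sup>*\<^bsub>with_proj ?H\<^esub> u"
  then obtain q where q: "H.apath v q u" using H.reachable_apath by blast
  have neq: "u \<noteq> v" using T.pair_no_loops[OF arc] by simp
  have walk: "v \<in> pverts T" "set q \<subseteq> parcs T - {(u, v), (v, u)}" "pcas v q u"
    "distinct (pawalk_verts v q)"
    using q by (auto simp: H.apath_def H.awalk_def)
  have "2 \<le> length q"
  proof (cases q)
    case Nil
    then show ?thesis using walk(3) neq by simp
  next
    case (Cons a q')
    then show ?thesis using walk(2,3) by (cases q') (auto simp: prod_eq_iff)
  qed
  moreover have "T.cycle ((u, v) # q)"
    unfolding T.cycle_def T.awalk_def
    using walk arc T.in_arcsD1[OF arc] by (intro exI[of _ u]) auto
  ultimately show False using T by (auto simp: simple_tree_def)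
qed

text \<open>The depth is the distance from \<open>c\<close>, and the parent is the predecessor on a
  shortest walk. An arc not of parent form could be deleted while its ends stay joined through
  \<open>c\<close> along parent arcs, contradicting \<open>no_path_around_arc\<close>.\<close>

lemma simple_tree_imp_rooted_tree:
  assumes T: "simple_tree T" and c: "c \<in> pverts T"
  shows "\<exists>p d. rooted_tree T c p d"
proof -
  interpret T: pair_graph T using T by (simp add: simple_tree_def)
  let ?V = "pverts T"
  define d where "d v = (LEAST k. (c, v) \<in> parcs T ^^ k)" for v
  have "strongly_connected (with_proj T)"
    using T T.pair_sym_arcs
    by (intro T.symmetric_connected_imp_strongly_connected) (auto simp: simple_tree_def)
  then have "c \<rightarrow>\<^sup>*\<^bsub>with_proj T\<^esub> v" if "v \<in> ?V" for v
    using that c by (auto simp: strongly_connected_def)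
  then have "(c, v) \<in> (parcs T)\<^sup>*" if "v \<in> ?V" for v
    using that T.reachable_conv by blast
  then have "\<exists>k. (c, v) \<in> parcs T ^^ k" if "v \<in> ?V" for v
    using that rtrancl_imp_relpow by blast
  then have d_walk: "(c, v) \<in> parcs T ^^ d v" if "v \<in> ?V" for v
    unfolding d_def using that by (metis LeastI_ex)
  have d_le: "d v \<le> k" if "(c, v) \<in> parcs T ^^ k" for v k
    unfolding d_def using that by (rule Least_le)
  have "\<exists>w. w \<in> ?V \<and> (w, v) \<in> parcs T \<and> d v = Suc (d w)" if v: "v \<in> ?V" "v \<noteq> c" for v
  proof (cases "d v")
    case 0
    then show ?thesis using d_walk[OF v(1)] v by simp
  next
    case (Suc k)
    then obtain w where w: "(c, w) \<in> parcs T ^^ k" "(w, v) \<in> parcs T"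
      using d_walk[OF v(1)] by auto
    have wV: "w \<in> ?V" using w(2) T.in_arcsD1 by blast
    have "(c, v) \<in> parcs T ^^ Suc (d w)" using d_walk[OF wV] w(2) by auto
    then have "d v \<le> Suc (d w)" by (rule d_le)
    moreover have "d w \<le> k" using w(1) by (rule d_le)
    ultimately show ?thesis using wV w(2) Suc by (intro exI[of _ w]) auto
  qed
  then obtain p where p: "\<And>v. v \<in> ?V \<Longrightarrow> v \<noteq> c \<Longrightarrow>
      p v \<in> ?V \<and> (p v, v) \<in> parcs T \<and> d v = Suc (d (p v))"
    by metis
  have "(u = p v \<and> v \<noteq> c) \<or> (v = p u \<and> u \<noteq> c)" if arc: "(u, v) \<in> parcs T" for u v
  proof (rule ccontr)
    assume neg: "\<not> ?thesis"
    let ?H = "\<lparr>pverts = ?V, parcs = parcs T - {(u, v), (v, u)}\<rparr>"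
    interpret H: pair_wf_digraph ?H by unfold_locales (auto dest: T.in_arcsD1 T.in_arcsD2)
    \<comment> \<open>The deleted edge is not a parent edge, so all parent edges survive; induction
      on the depth.\<close>
    have "x \<rightarrow>\<^sup>*\<^bsub>with_proj ?H\<^esub> c \<and> c \<rightarrow>\<^sup>*\<^bsub>with_proj ?H\<^esub> x" if "x \<in> ?V" for x
      using that
    proof (induction "d x" arbitrary: x rule: less_induct)
      case less
      show ?case
      proof (cases "x = c")
        case True
        then show ?thesis using c by simp
      next
        case False
        note px = p[OF less.prems False]
        have "(p x, x) \<in> parcs ?H" "(x, p x) \<in> parcs ?H"
          using px neg False T.arc_sym by auto
        then have "x \<rightarrow>\<^sup>*\<^bsub>with_proj ?H\<^esub> p x" "p x \<rightarrow>\<^sup>*\<^bsub>with_proj ?H\<^esub> x"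
          using H.reachable_adjI by auto
        moreover have "p x \<rightarrow>\<^sup>*\<^bsub>with_proj ?H\<^esub> c \<and> c \<rightarrow>\<^sup>*\<^bsub>with_proj ?H\<^esub> p x"
          using px by (intro less.hyps) auto
        ultimately show ?thesis using H.reachable_trans by blast
      qed
    qed
    then have "v \<rightarrow>\<^sup>*\<^bsub>with_proj ?H\<^esub> u"
      using T.in_arcsD1[OF arc] T.in_arcsD2[OF arc] H.reachable_trans by blast
    then show False using no_path_around_arc[OF T arc] by contradiction
  qed
  note parent_arc = this
  have arcs: "parcs T = (\<lambda>v. (v, p v)) ` (?V - {c}) \<union> (\<lambda>v. (p v, v)) ` (?V - {c})"
    (is "_ = ?E")
  proof (intro subset_antisym subrelI)
    fix u v assume uv: "(u, v) \<in> parcs T"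
    then have "u \<in> ?V" "v \<in> ?V" by (rule T.in_arcsD1, rule T.in_arcsD2)
    then show "(u, v) \<in> ?E" using parent_arc[OF uv] by blast
  next
    fix u v assume "(u, v) \<in> ?E"
    then consider "u \<in> ?V" "u \<noteq> c" "v = p u" | "v \<in> ?V" "v \<noteq> c" "u = p v"
      by auto
    then show "(u, v) \<in> parcs T"
    proof cases
      case 1
      then show ?thesis using p[OF 1(1,2)] T.arc_sym by blast
    next
      case 2
      then show ?thesis using p[OF 2(1,2)] by blast
    qed
  qed
  have "rooted_tree T c p d"
    by (intro rooted_tree.intro rooted_tree_axioms.intro T.pair_graph_axioms c arcs
        p[THEN conjunct1] p[THEN conjunct2, THEN conjunct2])
  then show ?thesis by (intro exI)
qed

lemma bij_betw_extend:
  assumes fin: "finite V" "finite W" and card: "card V = card W"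
    and A: "A \<subseteq> V" "inj_on g A" "g ` A \<subseteq> W"
  shows "\<exists>f. bij_betw f V W \<and> (\<forall>a\<in>A. f a = g a)"
proof -
  have "finite A" using A(1) fin(1) finite_subset by blast
  then have "card (V - A) = card (W - g ` A)"
    using A card by (simp add: card_Diff_subset card_image)
  then obtain h where h: "bij_betw h (V - A) (W - g ` A)"
    using fin by (meson finite_Diff finite_same_card_bij)
  have "bij_betw (\<lambda>x. if x \<in> A then g x else h x) (A \<union> (V - A)) (g ` A \<union> (W - g ` A))"
    using A(2) h by (intro bij_betw_disjoint_Un) (auto simp: bij_betw_def)
  moreover have "A \<union> (V - A) = V" "g ` A \<union> (W - g ` A) = W" using A by auto
  ultimately show ?thesis by (intro exI[of _ "\<lambda>x. if x \<in> A then g x else h x"]) auto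
qed

context rooted_tree
begin

lemma arc_iff:
  "u \<in> pverts G \<Longrightarrow> v \<in> pverts G \<Longrightarrow>
    (u, v) \<in> parcs G \<longleftrightarrow> (u \<noteq> c \<and> v = p u) \<or> (v \<noteq> c \<and> u = p v)"
  unfolding arcs by auto

lemma nbrs_root: "nbrs G c = {v \<in> pverts G. v \<noteq> c \<and> p v = c}"
proof (rule Set.set_eqI)
  fix v
  show "v \<in> nbrs G c \<longleftrightarrow> v \<in> {v \<in> pverts G. v \<noteq> c \<and> p v = c}"
    using arc_iff[OF root, of v] in_arcsD2[of c v] by auto
qed

lemma parent_neq: "v \<in> pverts G \<Longrightarrow> v \<noteq> c \<Longrightarrow> p v \<noteq> v"
  using depth[of v] by auto

text \<open>Outside the core \<open>A\<close> and its image every vertex is a child of the root, so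
  any bijection between the complements preserves parents. Only the finite pattern on
  \<open>A\<close> has to be checked.\<close>

lemma digraph_iso_extend:
  assumes H: "rooted_tree H r q d'" and card: "card (pverts G) = card (pverts H)"
    and A: "A \<subseteq> pverts G" "inj_on g A" "g ` A \<subseteq> pverts H" "c \<in> A" "g c = r"
    and pA: "\<And>v. v \<in> A \<Longrightarrow> v \<noteq> c \<Longrightarrow> p v \<in> A \<and> q (g v) = g (p v)"
    and pG: "\<And>v. v \<in> pverts G \<Longrightarrow> v \<notin> A \<Longrightarrow> p v = c"
    and pH: "\<And>i. i \<in> pverts H \<Longrightarrow> i \<notin> g ` A \<Longrightarrow> q i = r"
  shows "digraph_iso (with_proj G) (with_proj H)"
proof -
  interpret H: rooted_tree H r q d' by fact
  obtain f where f: "bij_betw f (pverts G) (pverts H)" and fg: "\<And>a. a \<in> A \<Longrightarrow> f a = g a"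
    using bij_betw_extend[OF pair_finite_verts H.pair_finite_verts card A(1-3)] by blast
  have inj: "f u = f v \<longleftrightarrow> u = v" if "u \<in> pverts G" "v \<in> pverts G" for u v
    using f that by (auto simp: bij_betw_def inj_on_def)
  have fV: "f v \<in> pverts H" if "v \<in> pverts G" for v using f that by (auto simp: bij_betw_def)
  have fc: "f c = r" using fg A by simp
  have fp: "q (f v) = f (p v)" if v: "v \<in> pverts G" "v \<noteq> c" for v
  proof (cases "v \<in> A")
    case True
    then show ?thesis using pA[OF True v(2)] fg by simp
  next
    case False
    have "f v \<notin> g ` A"
    proof
      assume "f v \<in> g ` A"
      then obtain a where "a \<in> A" "f v = f a" using fg by auto
      then show False using inj[of v a] v A(1) False by auto
    qed
    then show ?thesis using pH[OF fV[OF v(1)]] pG[OF v(1) False] fc by simp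
  qed
  have edge: "u \<noteq> c \<and> v = p u \<longleftrightarrow> f u \<noteq> r \<and> f v = q (f u)"
    if "u \<in> pverts G" "v \<in> pverts G" for u v
    using that inj[OF that(1) root] inj[OF that(2) parent[OF that(1)]] fp[OF that(1)] fc by metis
  have "\<forall>u\<in>pverts G. \<forall>v\<in>pverts G. (u, v) \<in> parcs G \<longleftrightarrow> (f u, f v) \<in> parcs H"
    using edge fV by (simp add: arc_iff H.arc_iff)
  then show ?thesis
    unfolding digraph_iso_pair_iff[OF pair_wf_digraph_axioms H.pair_wf_digraph_axioms]
    using f by blast
qed

end

text \<open>Numbering parents before their children keeps \<open>q\<close> in range and excludes
  loops.\<close>

lemma rooted_tree_graph_of_edges:
  fixes n :: nat
  assumes n: "0 < n" and E: "E = (\<lambda>i. (q i, i)) ` {1..<n}"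
    and q: "\<And>i. 0 < i \<Longrightarrow> i < n \<Longrightarrow> q i < i \<and> d i = Suc (d (q i))"
  shows "rooted_tree (graph_of_edges {0..<n} E) 0 q d"
proof -
  have "pair_graph (graph_of_edges {0..<n} E)"
  proof (rule pair_graph_graph_of_edges)
    have "q i < n \<and> q i \<noteq> i" if "i \<in> {1..<n}" for i using q[of i] that by auto
    then show "E \<subseteq> {0..<n} \<times> {0..<n}" "\<And>v. (v, v) \<notin> E" unfolding E by fastforce+
  qed simp
  then show ?thesis
  proof (intro rooted_tree.intro rooted_tree_axioms.intro)
    let ?G = "graph_of_edges {0..<n} E"
    show "0 \<in> pverts ?G" using n by (simp add: graph_of_edges_def)
    show "q v \<in> pverts ?G" "d v = Suc (d (q v))" if "v \<in> pverts ?G" "v \<noteq> 0" for v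
      using q[of v] that by (simp_all add: graph_of_edges_def)
    have "pverts ?G - {0} = {1..<n}" by (auto simp: graph_of_edges_def)
    then show "parcs ?G = (\<lambda>v. (v, q v)) ` (pverts ?G - {0}) \<union> (\<lambda>v. (q v, v)) ` (pverts ?G - {0})"
      by (auto simp: graph_of_edges_def E)
  qed
qed

lemma rooted_tree_star:
  assumes "12 \<le> n"
  shows "rooted_tree (star n) 0 (\<lambda>i. 0) (\<lambda>i. if i = 0 then 0 else 1)"
  unfolding star_def using assms by (intro rooted_tree_graph_of_edges) auto

lemma rooted_tree_T1:
  assumes "12 \<le> n"
  shows "rooted_tree (T1 n) 0 (\<lambda>i. if i = n - 1 then n - 2 else 0)
    (\<lambda>i. if i = 0 then 0 else if i = n - 1 then 2 else 1)"
proof -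
  \<comment> \<open>Writing \<open>n\<close> as \<open>m + 4\<close> turns the truncated differences
    into sums.\<close>
  obtain m where "n = m + 4" using le_Suc_ex[of 4 n] assms by auto
  then show ?thesis
    unfolding T1_def by (intro rooted_tree_graph_of_edges) (auto simp: image_iff split: if_splits)
qed

lemma rooted_tree_T2:
  assumes "12 \<le> n"
  shows "rooted_tree (T2 n) 0 (\<lambda>i. if i = n - 1 then n - 2 else if i = n - 2 then n - 3 else 0)
    (\<lambda>i. if i = 0 then 0 else if i = n - 1 then 3 else if i = n - 2 then 2 else 1)"
proof -
  obtain m where "n = m + 4" using le_Suc_ex[of 4 n] assms by auto
  then show ?thesis
    unfolding T2_def by (intro rooted_tree_graph_of_edges) (auto simp: image_iff split: if_splits)
qed

lemma rooted_tree_T3: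
  assumes "12 \<le> n"
  shows "rooted_tree (T3 n) 0 (\<lambda>i. if n - 2 \<le> i then n - 3 else 0)
    (\<lambda>i. if i = 0 then 0 else if n - 2 \<le> i then 2 else 1)"
proof -
  obtain m where "n = m + 4" using le_Suc_ex[of 4 n] assms by auto
  then show ?thesis
    unfolding T3_def by (intro rooted_tree_graph_of_edges) (auto simp: image_iff split: if_splits)
qed

lemma rooted_tree_T4:
  assumes "12 \<le> n"
  shows "rooted_tree (T4 n) 0 (\<lambda>i. if i = n - 1 then n - 3 else if i = n - 2 then n - 4 else 0)
    (\<lambda>i. if i = 0 then 0 else if n - 2 \<le> i then 2 else 1)"
proof -
  obtain m where "n = m + 5" using le_Suc_ex[of 5 n] assms by auto
  then show ?thesis
    unfolding T4_def by (intro rooted_tree_graph_of_edges) (auto simp: image_iff split: if_splits)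
qed

lemma pverts_extremal [simp]:
  "pverts (star n) = {0..<n}" "pverts (T1 n) = {0..<n}" "pverts (T2 n) = {0..<n}"
  "pverts (T3 n) = {0..<n}" "pverts (T4 n) = {0..<n}"
  by (simp_all add: star_def T1_def T2_def T3_def T4_def graph_of_edges_def)

text \<open>At most two vertices lie at depth two or more below \<open>c\<close>. None gives the
  star and one gives \<open>T1\<close>; for two, the cases are a path, a common parent, or distinct
  children of \<open>c\<close> as parents, giving \<open>T2\<close>, \<open>T3\<close>,
  \<open>T4\<close>.\<close>

lemma (in rooted_tree) digraph_iso_of_large_degree:
  assumes n: "12 \<le> n" "card (pverts G) = n" and deg: "n - 3 \<le> card (nbrs G c)"
  shows "digraph_iso (with_proj G) (with_proj (star n)) \<or> digraph_iso (with_proj G) (with_proj (T1 n)) \<or>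
    digraph_iso (with_proj G) (with_proj (T2 n)) \<or> digraph_iso (with_proj G) (with_proj (T3 n)) \<or>
    digraph_iso (with_proj G) (with_proj (T4 n))"
proof -
  define R where "R = pverts G - insert c (nbrs G c)"
  have R: "v \<in> R \<longleftrightarrow> v \<in> pverts G \<and> v \<noteq> c \<and> p v \<noteq> c" for v
    by (auto simp: R_def nbrs_root)
  have "card (insert c (nbrs G c)) = Suc (card (nbrs G c))"
    using finite_nbrs nbrs_irrefl by simp
  moreover have "insert c (nbrs G c) \<subseteq> pverts G" using nbrs_subset root by auto
  ultimately have "card R = n - Suc (card (nbrs G c))"
    using n finite_nbrs by (simp add: R_def card_Diff_subset)
  then have cardR: "card R \<le> 2" using deg by linarith
  have finR: "finite R" using pair_finite_verts by (simp add: R_def)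
  have pR: "p v \<in> pverts G" "p v \<noteq> c" "p v \<noteq> v" if "v \<in> R" for v
    using that parent parent_neq by (auto simp: R)
  have pu: "p u = c" if "u \<in> pverts G" "u \<notin> R" "u \<noteq> c" for u using that R by auto
  obtain m where m: "n = m + 5" using le_Suc_ex[of 5 n] n by auto
  consider "R = {}" | z where "R = {z}" | w z where "R = {w, z}" "w \<noteq> z"
  proof -
    have "card R = 0 \<or> card R = 1 \<or> card R = 2" using cardR by linarith
    then show ?thesis using that finR by (auto simp: card_1_singleton_iff card_2_iff)
  qed
  then show ?thesis
  proof cases
    case 1
    have "digraph_iso (with_proj G) (with_proj (star n))"
      by (rule digraph_iso_extend[OF rooted_tree_star[OF n(1)], where A = "{c}" and g = "\<lambda>_. 0"])
        (use n root 1 R in auto)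
    then show ?thesis by blast
  next
    case (2 z)
    have z: "z \<in> pverts G" "p z \<in> pverts G" and neq: "z \<noteq> c" "p z \<noteq> c" "p z \<noteq> z"
      using 2 R pR[of z] by auto
    have others: "p v = c" if "v \<in> pverts G" "v \<noteq> c" "v \<noteq> z" for v using pu[of v] that 2 by auto
    have "digraph_iso (with_proj G) (with_proj (T1 n))"
      by (rule digraph_iso_extend[OF rooted_tree_T1[OF n(1)], where A = "{c, p z, z}" and
            g = "(\<lambda>_. 0)(p z := n - 2, z := n - 1)"])
        (auto simp: m n(2) root z neq neq[THEN not_sym] others inj_on_def)
    then show ?thesis by blast
  next
    case (3 w' z')
    have "\<not> (p w' = z' \<and> p z' = w')"
    proof
      assume a: "p w' = z' \<and> p z' = w'"
      have "w' \<in> R" "z' \<in> R" using 3 by simp_all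
      then have "d w' = Suc (d (p w'))" "d z' = Suc (d (p z'))" by (simp_all add: R depth)
      then show False using a by simp
    qed
    \<comment> \<open>The two are named so that the parent of \<open>w\<close> is not
      \<open>z\<close>; hence \<open>p w\<close> is a child of \<open>c\<close>.\<close>
    then obtain w z where wz: "R = {w, z}" "w \<noteq> z" "p w \<noteq> z"
      using 3 by (metis insert_commute)
    have V: "w \<in> pverts G" "z \<in> pverts G" "p w \<in> pverts G" "p z \<in> pverts G"
      and neq: "w \<noteq> z" "w \<noteq> c" "z \<noteq> c" "p w \<noteq> z" "p w \<noteq> c" "p w \<noteq> w" "p z \<noteq> c" "p z \<noteq> z"
      using wz R pR[of w] pR[of z] by auto
    have others: "p v = c" if "v \<in> pverts G" "v \<noteq> c" "v \<noteq> w" "v \<noteq> z" for v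
      using pu[of v] that wz by auto
    note facts = m n(2) root V neq neq[THEN not_sym] others inj_on_def
    show ?thesis
    proof (cases "p z = w")
      case True
      have "digraph_iso (with_proj G) (with_proj (T2 n))"
        by (rule digraph_iso_extend[OF rooted_tree_T2[OF n(1)], where A = "{c, p w, w, z}" and
              g = "(\<lambda>_. 0)(p w := n - 3, w := n - 2, z := n - 1)"])
          (auto simp: facts True)
      then show ?thesis by blast
    next
      case pz: False
      show ?thesis
      proof (cases "p z = p w")
        case True
        have "digraph_iso (with_proj G) (with_proj (T3 n))"
          by (rule digraph_iso_extend[OF rooted_tree_T3[OF n(1)], where A = "{c, p w, w, z}" and
                g = "(\<lambda>_. 0)(p w := n - 3, w := n - 2, z := n - 1)"])
            (auto simp: facts True)
        then show ?thesis by blast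
      next
        case False
        have "digraph_iso (with_proj G) (with_proj (T4 n))"
          by (rule digraph_iso_extend[OF rooted_tree_T4[OF n(1)], where A = "{c, p w, p z, w, z}" and
                g = "(\<lambda>_. 0)(p w := n - 4, p z := n - 3, w := n - 2, z := n - 1)"])
            (auto simp: facts pz pz[THEN not_sym] False False[THEN not_sym])
        then show ?thesis by blast
      qed
    qed
  qed
qed

section \<open>The extremal trees\<close>

lemma nbrs_star:
  shows "nbrs (star n) 0 = {1..<n}"
    and "i \<in> {1..<n} \<Longrightarrow> nbrs (star n) i = {0}"
  by (auto simp: star_def graph_of_edges_def)

lemma nbrs_T1:
  assumes "12 \<le> n"
  shows "nbrs (T1 n) 0 = {1..n - 3} \<union> {n - 2}"
    and "i \<in> {1..n - 3} \<Longrightarrow> nbrs (T1 n) i = {0}"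
    and "nbrs (T1 n) (n - 2) = {0, n - 1}"
    and "nbrs (T1 n) (n - 1) = {n - 2}"
  using assms by (auto simp: T1_def graph_of_edges_def)

lemma nbrs_T2:
  assumes "12 \<le> n"
  shows "nbrs (T2 n) 0 = {1..n - 4} \<union> {n - 3}"
    and "i \<in> {1..n - 4} \<Longrightarrow> nbrs (T2 n) i = {0}"
    and "nbrs (T2 n) (n - 3) = {0, n - 2}"
    and "nbrs (T2 n) (n - 2) = {n - 3, n - 1}"
    and "nbrs (T2 n) (n - 1) = {n - 2}"
  using assms by (auto simp: T2_def graph_of_edges_def)

lemma nbrs_T3:
  assumes "12 \<le> n"
  shows "nbrs (T3 n) 0 = {1..n - 4} \<union> {n - 3}"
    and "i \<in> {1..n - 4} \<Longrightarrow> nbrs (T3 n) i = {0}"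
    and "nbrs (T3 n) (n - 3) = {0, n - 2, n - 1}"
    and "i \<in> {n - 2, n - 1} \<Longrightarrow> nbrs (T3 n) i = {n - 3}"
  using assms by (auto simp: T3_def graph_of_edges_def)

lemma nbrs_T4:
  assumes "12 \<le> n"
  shows "nbrs (T4 n) 0 = {1..n - 5} \<union> {n - 4, n - 3}"
    and "i \<in> {1..n - 5} \<Longrightarrow> nbrs (T4 n) i = {0}"
    and "nbrs (T4 n) (n - 4) = {0, n - 2}" and "nbrs (T4 n) (n - 3) = {0, n - 1}"
    and "nbrs (T4 n) (n - 2) = {n - 4}" and "nbrs (T4 n) (n - 1) = {n - 3}"
  using assms by (auto simp: T4_def graph_of_edges_def)

lemma card_nbrs_root:
  assumes "12 \<le> n"
  shows "card (nbrs (T1 n) 0) = n - 2" "card (nbrs (T2 n) 0) = n - 3"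
    "card (nbrs (T3 n) 0) = n - 3" "card (nbrs (T4 n) 0) = n - 3"
proof -
  have "nbrs (T1 n) 0 = {1..n - 2}" "nbrs (T2 n) 0 = {1..n - 3}"
    "nbrs (T3 n) 0 = {1..n - 3}" "nbrs (T4 n) 0 = {1..n - 3}"
    using assms by (auto simp: T1_def T2_def T3_def T4_def graph_of_edges_def)
  then show "card (nbrs (T1 n) 0) = n - 2" "card (nbrs (T2 n) 0) = n - 3"
    "card (nbrs (T3 n) 0) = n - 3" "card (nbrs (T4 n) 0) = n - 3" by simp_all
qed

lemma ext_spectral_radius_star_ge:
  assumes n: "12 \<le> n" and D: "D = real n - 1"
  shows "D * (D + 1 / D)\<^sup>2 \<le> 4 * (\<eta>\<^sub>1 (star n))\<^sup>2"
proof -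
  interpret rooted_tree "star n" 0 "\<lambda>i. 0" "\<lambda>i. if i = 0 then 0 else 1" by (rule rooted_tree_star) fact
  \<comment> \<open>All neighbours are leaves; the second class is empty, with dummy degree
    1.\<close>
  have "real (card {1..<n}) * (D + 1 / D)\<^sup>2 + real (card ({} :: nat set)) * (D / real 1 + real 1 / D)\<^sup>2
      \<le> 4 * (\<eta>\<^sub>1 (star n))\<^sup>2"
    by (rule ext_spectral_radius_ge_two_degrees[of 0]) (use n D in \<open>auto simp: nbrs_star\<close>)
  then show ?thesis using n D by (simp add: of_nat_diff)
qed

lemma ext_spectral_radius_T1_ge:
  assumes n: "12 \<le> n" and D: "D = real n - 2"
  shows "(D - 1) * (D + 1 / D)\<^sup>2 + (D / 2 + 2 / D)\<^sup>2 \<le> 4 * (\<eta>\<^sub>1 (T1 n))\<^sup>2"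
proof -
  interpret pair_graph "T1 n" using n by (intro pair_graph_T1) simp
  have "real (card {1..n - 3}) * (D + 1 / D)\<^sup>2 + real (card {n - 2}) * (D / real 2 + real 2 / D)\<^sup>2
      \<le> 4 * (\<eta>\<^sub>1 (T1 n))\<^sup>2"
  proof (rule ext_spectral_radius_ge_two_degrees[of 0])
    show "D = real (card (nbrs (T1 n) 0))" using n D by (simp add: card_nbrs_root)
  qed (use n in \<open>auto simp: nbrs_T1\<close>)
  then show ?thesis using n D by (simp add: of_nat_diff)
qed

lemma ext_spectral_radius_T2_ge:
  assumes n: "12 \<le> n" and D: "D = real n - 3"
  shows "(D - 1) * (D + 1 / D)\<^sup>2 + (D / 2 + 2 / D)\<^sup>2 \<le> 4 * (\<eta>\<^sub>1 (T2 n))\<^sup>2"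
proof -
  interpret pair_graph "T2 n" using n by (intro pair_graph_T2) simp
  have "real (card {1..n - 4}) * (D + 1 / D)\<^sup>2 + real (card {n - 3}) * (D / real 2 + real 2 / D)\<^sup>2
      \<le> 4 * (\<eta>\<^sub>1 (T2 n))\<^sup>2"
  proof (rule ext_spectral_radius_ge_two_degrees[of 0])
    show "D = real (card (nbrs (T2 n) 0))" using n D by (simp add: card_nbrs_root)
  qed (use n in \<open>auto simp: nbrs_T2\<close>)
  then show ?thesis using n D by (simp add: of_nat_diff)
qed

lemma ext_spectral_radius_T3_ge:
  assumes n: "12 \<le> n" and D: "D = real n - 3"
  shows "(D - 1) * (D + 1 / D)\<^sup>2 + (D / 3 + 3 / D)\<^sup>2 \<le> 4 * (\<eta>\<^sub>1 (T3 n))\<^sup>2"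
proof -
  interpret pair_graph "T3 n" using n by (intro pair_graph_T3) simp
  have "real (card {1..n - 4}) * (D + 1 / D)\<^sup>2 + real (card {n - 3}) * (D / real 3 + real 3 / D)\<^sup>2
      \<le> 4 * (\<eta>\<^sub>1 (T3 n))\<^sup>2"
  proof (rule ext_spectral_radius_ge_two_degrees[of 0])
    show "D = real (card (nbrs (T3 n) 0))" using n D by (simp add: card_nbrs_root)
  qed (use n in \<open>auto simp: nbrs_T3\<close>)
  then show ?thesis using n D by (simp add: of_nat_diff)
qed

lemma ext_spectral_radius_T4_ge:
  assumes n: "12 \<le> n" and D: "D = real n - 3"
  shows "(D - 2) * (D + 1 / D)\<^sup>2 + 2 * (D / 2 + 2 / D)\<^sup>2 \<le> 4 * (\<eta>\<^sub>1 (T4 n))\<^sup>2"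
proof -
  interpret pair_graph "T4 n" using n by (intro pair_graph_T4) simp
  have "real (card {1..n - 5}) * (D + 1 / D)\<^sup>2 + real (card {n - 4, n - 3}) * (D / real 2 + real 2 / D)\<^sup>2
      \<le> 4 * (\<eta>\<^sub>1 (T4 n))\<^sup>2"
  proof (rule ext_spectral_radius_ge_two_degrees[of 0])
    show "D = real (card (nbrs (T4 n) 0))" using n D by (simp add: card_nbrs_root)
  qed (use n in \<open>auto simp: nbrs_T4\<close>)
  then show ?thesis using n D by (simp add: of_nat_diff)
qed

text \<open>Here \<open>a = n - 3\<close> and \<open>j = 1\<close>: the degrees
  \<open>n - 2\<close>, 2 and 1 of \<open>T1\<close> are themselves the extreme
  configuration.\<close>

lemma ext_spectral_radius_T1_le:
  assumes n: "12 \<le> n"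
  shows "4 * (\<eta>\<^sub>1 (T1 n))\<^sup>2 \<le> (real n - 2) ^ 3 + 8 + 3 * (real n - 2) + 2"
proof -
  interpret rooted_tree "T1 n" 0 "\<lambda>i. if i = n - 1 then n - 2 else 0"
    "\<lambda>i. if i = 0 then 0 else if i = n - 1 then 2 else 1" by (rule rooted_tree_T1) fact
  have "4 * (\<eta>\<^sub>1 (T1 n))\<^sup>2 \<le> (real (n - 3) + 1) ^ 3 + (real 1 + 1) ^ 3 + 3 * (real (n - 3) + real 1) + 2"
  proof (rule ext_spectral_radius_le_max_degree)
    show "card (nbrs (T1 n) v) \<le> n - 3 + 1" if "v \<in> pverts (T1 n)" for v
    proof -
      have "v = 0 \<or> v \<in> {1..n - 3} \<or> v = n - 2 \<or> v = n - 1" using that by (simp, arith)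
      then show ?thesis using n by (elim disjE) (simp_all add: nbrs_T1(2-) nbrs_T1(4)[simplified] card_nbrs_root)
    qed
  qed (use n in auto)
  then show ?thesis using n by (simp add: of_nat_diff)
qed

text \<open>Here \<open>a = n - 4\<close> and \<open>j = 2\<close>: the degrees
  \<open>n - 3\<close>, 2, 2 are replaced by the extreme \<open>n - 3\<close>, 3, which is still
  sharp enough for the comparison with \<open>T1\<close>.\<close>

lemma ext_spectral_radius_T2_le:
  assumes n: "12 \<le> n"
  shows "4 * (\<eta>\<^sub>1 (T2 n))\<^sup>2 \<le> (real n - 3) ^ 3 + 27 + 3 * (real n - 2) + 2"
proof -
  interpret rooted_tree "T2 n" 0 "\<lambda>i. if i = n - 1 then n - 2 else if i = n - 2 then n - 3 else 0"
    "\<lambda>i. if i = 0 then 0 else if i = n - 1 then 3 else if i = n - 2 then 2 else 1"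
    by (rule rooted_tree_T2) fact
  have "4 * (\<eta>\<^sub>1 (T2 n))\<^sup>2 \<le> (real (n - 4) + 1) ^ 3 + (real 2 + 1) ^ 3 + 3 * (real (n - 4) + real 2) + 2"
  proof (rule ext_spectral_radius_le_max_degree)
    show "card (nbrs (T2 n) v) \<le> n - 4 + 1" if "v \<in> pverts (T2 n)" for v
    proof -
      have "v = 0 \<or> v \<in> {1..n - 4} \<or> v = n - 3 \<or> v = n - 2 \<or> v = n - 1"
        using that by (simp, arith)
      then show ?thesis using n by (elim disjE) (simp_all add: nbrs_T2(2-) nbrs_T2(5)[simplified] card_nbrs_root)
    qed
  qed (use n in auto)
  then show ?thesis using n by (simp add: of_nat_diff)
qed

lemma square_sum_inverse:
  fixes D e :: real
  assumes "D \<noteq> 0" "e \<noteq> 0"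
  shows "(D / e + e / D)\<^sup>2 = D\<^sup>2 / e\<^sup>2 + 2 + e\<^sup>2 / D\<^sup>2"
  using assms by (simp add: power2_eq_square field_simps)

lemma square_sum_inverse_ge:
  fixes D e :: real
  assumes "D \<noteq> 0" "e \<noteq> 0"
  shows "D\<^sup>2 / e\<^sup>2 + 2 \<le> (D / e + e / D)\<^sup>2"
  unfolding square_sum_inverse[OF assms] by simp

text \<open>Depth two with \<open>e = 3\<close>. The bound exceeds that of
  \<open>ext_spectral_radius_T3_ge\<close> by exactly 1. The remaining condition holds because the
  leaves contribute order \<open>D^3\<close>, against a constant times \<open>D^2\<close>.\<close>

lemma ext_spectral_radius_T3_le:
  assumes n: "12 \<le> n" and D: "D = real n - 3"
  shows "4 * (\<eta>\<^sub>1 (T3 n))\<^sup>2 \<le> (D - 1) * (D + 1 / D)\<^sup>2 + (D / 3 + 3 / D)\<^sup>2 + 1"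
proof -
  interpret pair_graph "T3 n" using n by (intro pair_graph_T3) simp
  have D9: "9 \<le> D" using n D by simp
  let ?L = "{1..n - 4}" and ?U = "{n - 3}"
  have cards: "real (card ?L) = D - 1" "real (card ?U) = 1" using n D by (simp_all add: of_nat_diff)
  have sq: "81 \<le> D\<^sup>2" using power_mono[OF D9, of 2] by simp
  have W: "D\<^sup>2 + 2 \<le> (D + 1 / D)\<^sup>2" using square_sum_inverse_ge[of D 1] D9 by simp
  \<comment> \<open>The 8 is the lower bound for \<open>D - 1\<close>; replacing only this factor
    leaves enough room.\<close>
  have A: "8 * (D\<^sup>2 + 2) \<le> (D - 1) * (D + 1 / D)\<^sup>2"
    by (rule mult_mono) (use D9 W in auto)
  have "9 / D\<^sup>2 \<le> 1" using sq D9 by (simp add: divide_le_eq)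
  then have b: "(D / 3 + 3 / D)\<^sup>2 \<le> D\<^sup>2 / 9 + 3"
    using square_sum_inverse[of D 3] D9 by simp
  have t: "(real 3 - 1) * (real 3 + 1 / real 3)\<^sup>2 = 200 / 9" by (simp add: power2_eq_square)
  have "4 * (\<eta>\<^sub>1 (T3 n))\<^sup>2 \<le> real (card ?L) * (D + 1 / D)\<^sup>2
      + real (card ?U) * (D / real 3 + real 3 / D)\<^sup>2 + 1"
  proof (rule ext_spectral_radius_le_depth_two[of 0])
    show "pverts (T3 n) \<subseteq> {0} \<union> ?L \<union> ?U \<union> (\<Union>u\<in>?U. nbrs (T3 n) u)"
      using n by (auto simp: nbrs_T3)
    show "(real 3 - 1) * (real 3 + 1 / real 3)\<^sup>2 < real (card ?L) * (D + 1 / D)\<^sup>2"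
    proof -
      have "200 / 9 < 8 * (D\<^sup>2 + 2)" using sq by simp
      then show ?thesis unfolding t cards using A by (rule less_le_trans)
    qed
    show "(real 3 - 1) * (real 3 + 1 / real 3)\<^sup>2
          * (real (card ?U) * (D / real 3 + real 3 / D)\<^sup>2 + 1)
        \<le> real (card ?L) * (D + 1 / D)\<^sup>2 + real (card ?U) * (D / real 3 + real 3 / D)\<^sup>2 + 1"
      unfolding t cards using A b sq D9 by simp
    show "D = real (card (nbrs (T3 n) 0))" using n D by (simp add: card_nbrs_root)
    show "card (nbrs (T3 n) u) = 3" if "u \<in> ?U" for u using that n by (auto simp: nbrs_T3)
    show "nbrs (T3 n) z = {u}" if "u \<in> ?U" "z \<in> nbrs (T3 n) u" "z \<noteq> 0" for u z
      using that n by (auto simp: nbrs_T3)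
  qed (use n D in \<open>auto simp: nbrs_T3\<close>)
  then show ?thesis unfolding cards by simp
qed

text \<open>Depth two with \<open>e = 2\<close> and two branches; again exactly 1 above the lower
  bound of \<open>ext_spectral_radius_T4_ge\<close>.\<close>

lemma ext_spectral_radius_T4_le:
  assumes n: "12 \<le> n" and D: "D = real n - 3"
  shows "4 * (\<eta>\<^sub>1 (T4 n))\<^sup>2 \<le> (D - 2) * (D + 1 / D)\<^sup>2 + 2 * (D / 2 + 2 / D)\<^sup>2 + 1"
proof -
  interpret pair_graph "T4 n" using n by (intro pair_graph_T4) simp
  have D9: "9 \<le> D" using n D by simp
  let ?L = "{1..n - 5}" and ?U = "{n - 4, n - 3}"
  have "n - 4 \<noteq> n - 3" using n by arith
  then have cards: "real (card ?L) = D - 2" "real (card ?U) = 2"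
    using n D by (simp_all add: of_nat_diff)
  have sq: "81 \<le> D\<^sup>2" using power_mono[OF D9, of 2] by simp
  have W: "D\<^sup>2 + 2 \<le> (D + 1 / D)\<^sup>2" using square_sum_inverse_ge[of D 1] D9 by simp
  have A: "7 * (D\<^sup>2 + 2) \<le> (D - 2) * (D + 1 / D)\<^sup>2"
    by (rule mult_mono) (use D9 W in auto)
  have "4 / D\<^sup>2 \<le> 1" using sq D9 by (simp add: divide_le_eq)
  then have b: "(D / 2 + 2 / D)\<^sup>2 \<le> D\<^sup>2 / 4 + 3"
    using square_sum_inverse[of D 2] D9 by simp
  have t: "(real 2 - 1) * (real 2 + 1 / real 2)\<^sup>2 = 25 / 4" by (simp add: power2_eq_square)
  have "4 * (\<eta>\<^sub>1 (T4 n))\<^sup>2 \<le> real (card ?L) * (D + 1 / D)\<^sup>2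
      + real (card ?U) * (D / real 2 + real 2 / D)\<^sup>2 + 1"
  proof (rule ext_spectral_radius_le_depth_two[of 0])
    show "pverts (T4 n) \<subseteq> {0} \<union> ?L \<union> ?U \<union> (\<Union>u\<in>?U. nbrs (T4 n) u)"
      using n by (auto simp: nbrs_T4)
    show "(real 2 - 1) * (real 2 + 1 / real 2)\<^sup>2 < real (card ?L) * (D + 1 / D)\<^sup>2"
    proof -
      have "25 / 4 < 7 * (D\<^sup>2 + 2)" using sq by simp
      then show ?thesis unfolding t cards using A by (rule less_le_trans)
    qed
    show "(real 2 - 1) * (real 2 + 1 / real 2)\<^sup>2
          * (real (card ?U) * (D / real 2 + real 2 / D)\<^sup>2 + 1)
        \<le> real (card ?L) * (D + 1 / D)\<^sup>2 + real (card ?U) * (D / real 2 + real 2 / D)\<^sup>2 + 1"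
      unfolding t cards using A b sq D9 by simp
    show "D = real (card (nbrs (T4 n) 0))" using n D by (simp add: card_nbrs_root)
    show "card (nbrs (T4 n) u) = 2" if "u \<in> ?U" for u using that n by (auto simp: nbrs_T4)
    show "nbrs (T4 n) z = {u}" if "u \<in> ?U" "z \<in> nbrs (T4 n) u" "z \<noteq> 0" for u z
    proof -
      have "u = n - 4 \<and> z = n - 2 \<or> u = n - 3 \<and> z = n - 1"
        using that nbrs_T4(3,4)[OF n] by (metis insertE singletonD)
      then show ?thesis using nbrs_T4(5,6)[OF n] by (elim disjE conjE) (simp_all only:)
    qed
  qed (use n D in \<open>auto simp: nbrs_T4\<close>)
  then show ?thesis unfolding cards by simp
qed

section \<open>Comparison of the bounds\<close>

lemma ext_spectral_radius_nonneg:
  assumes "12 \<le> n"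
  shows "0 \<le> \<eta>\<^sub>1 (star n)" "0 \<le> \<eta>\<^sub>1 (T1 n)" "0 \<le> \<eta>\<^sub>1 (T2 n)" "0 \<le> \<eta>\<^sub>1 (T3 n)" "0 \<le> \<eta>\<^sub>1 (T4 n)"
  using assms pair_graph_star[of n] pair_graph_T1[of n] pair_graph_T2[of n] pair_graph_T3[of n] pair_graph_T4[of n]
  by (auto intro!: pair_graph.ext_spectral_radius_ge_star(2)[of _ 0])

lemma less_of_square_bounds:
  fixes x y :: real
  assumes "4 * x\<^sup>2 \<le> a" "a < b" "b \<le> 4 * y\<^sup>2" "0 \<le> y"
  shows "x < y"
  using power2_less_imp_less[of x y] assms by linarith

theorem theorem1p3:
  fixes n :: nat and T :: "'a pair_pre_digraph"
  assumes "12 \<le> n"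
    and "simple_tree T" and "card (pverts T) = n"
    and "\<not> digraph_iso (with_proj T) (with_proj (star n))"
    and "\<not> digraph_iso (with_proj T) (with_proj (T1 n))"
    and "\<not> digraph_iso (with_proj T) (with_proj (T2 n))"
    and "\<not> digraph_iso (with_proj T) (with_proj (T3 n))"
    and "\<not> digraph_iso (with_proj T) (with_proj (T4 n))"
  shows "\<eta>\<^sub>1 T < \<eta>\<^sub>1 (T4 n) \<and> \<eta>\<^sub>1 (T4 n) < \<eta>\<^sub>1 (T3 n) \<and> \<eta>\<^sub>1 (T3 n) < \<eta>\<^sub>1 (T2 n)
    \<and> \<eta>\<^sub>1 (T2 n) < \<eta>\<^sub>1 (T1 n) \<and> \<eta>\<^sub>1 (T1 n) < \<eta>\<^sub>1 (star n)"
proof -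
  note n = assms(1) and nonneg = ext_spectral_radius_nonneg[OF assms(1)]
  define D where "D = real n - 3"
  have D9: "9 \<le> D" using n by (simp add: D_def)
  have sq: "81 \<le> D\<^sup>2" using power_mono[OF D9, of 2] by simp
  have leaf: "D\<^sup>2 + 2 \<le> (D + 1 / D)\<^sup>2" using square_sum_inverse_ge[of D 1] D9 by simp
  have inv: "0 \<le> 4 / D\<^sup>2" "4 / D\<^sup>2 \<le> 1" "0 \<le> 9 / D\<^sup>2" "9 / D\<^sup>2 \<le> 1"
    using sq D9 by (simp_all add: divide_le_eq)
  have half: "(D / 2 + 2 / D)\<^sup>2 = D\<^sup>2 / 4 + 2 + 4 / D\<^sup>2" "(D / 3 + 3 / D)\<^sup>2 = D\<^sup>2 / 9 + 2 + 9 / D\<^sup>2"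
    using square_sum_inverse[of D 2] square_sum_inverse[of D 3] D9 by simp_all

  have "\<eta>\<^sub>1 T < \<eta>\<^sub>1 (T4 n)"
  proof (rule less_of_square_bounds[OF _ _ ext_spectral_radius_T4_ge[OF n D_def] nonneg(5)])
    \<comment> \<open>A vertex of degree at least \<open>n - 3\<close> would make \<open>T\<close>
      one of the five exceptions. The degree bound thus applies with \<open>a = n - 5\<close> and
      \<open>j = 3\<close>.\<close>
    have small: "card (nbrs T v) \<le> n - 5 + 1" if v: "v \<in> pverts T" for v
    proof (rule ccontr)
      assume "\<not> ?thesis"
      then have large: "n - 3 \<le> card (nbrs T v)" using n by linarith
      obtain p d where "rooted_tree T v p d" using simple_tree_imp_rooted_tree[OF assms(2) v] by blast
      then show False using rooted_tree.digraph_iso_of_large_degree[OF _ n assms(3) large] assms(4-8) by blast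
    qed
    have "pverts T \<noteq> {}" using n assms(3) by auto
    then obtain c where "c \<in> pverts T" by blast
    then obtain p d where "rooted_tree T c p d" using simple_tree_imp_rooted_tree[OF assms(2)] by blast
    then interpret rooted_tree T c p d .
    have "4 * (\<eta>\<^sub>1 T)\<^sup>2 \<le> (real (n - 5) + 1) ^ 3 + (real 3 + 1) ^ 3 + 3 * (real (n - 5) + real 3) + 2"
      by (rule ext_spectral_radius_le_max_degree) (use n assms(3) small in auto)
    then show "4 * (\<eta>\<^sub>1 T)\<^sup>2 \<le> (D - 1) ^ 3 + 64 + 3 * (D + 1) + 2"
      using n by (simp add: of_nat_diff D_def)
    have "(D - 2) * (D\<^sup>2 + 2) \<le> (D - 2) * (D + 1 / D)\<^sup>2"
      using leaf D9 by (intro mult_left_mono) auto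
    \<comment> \<open>Twice the difference of the sides is
      \<open>(D - 9) * (3 * D + 19) + 35\<close>.\<close>
    moreover have "(D - 1) ^ 3 + 64 + 3 * (D + 1) + 2 < (D - 2) * (D\<^sup>2 + 2) + D\<^sup>2 / 2 + 4"
      using mult_nonneg_nonneg[of "D - 9" "3 * D + 19"] D9
      by (simp add: algebra_simps power2_eq_square power3_eq_cube)
    ultimately show "(D - 1) ^ 3 + 64 + 3 * (D + 1) + 2
        < (D - 2) * (D + 1 / D)\<^sup>2 + 2 * (D / 2 + 2 / D)\<^sup>2"
      unfolding half using inv(1) by argo
  qed

  moreover have "\<eta>\<^sub>1 (T4 n) < \<eta>\<^sub>1 (T3 n)"
  proof (rule less_of_square_bounds[OF ext_spectral_radius_T4_le[OF n D_def] _
        ext_spectral_radius_T3_ge[OF n D_def] nonneg(4)])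
    \<comment> \<open>After cancelling \<open>D * (D + 1 / D)\<^sup>2\<close>, the difference has
      leading term \<open>(1 + 1/9 - 1/2) * D\<^sup>2\<close>: \<open>T3\<close> has one more leaf
      at the centre.\<close>
    show "(D - 2) * (D + 1 / D)\<^sup>2 + 2 * (D / 2 + 2 / D)\<^sup>2 + 1
        < (D - 1) * (D + 1 / D)\<^sup>2 + (D / 3 + 3 / D)\<^sup>2"
      unfolding half left_diff_distrib using leaf inv sq by argo
  qed

  moreover have "\<eta>\<^sub>1 (T3 n) < \<eta>\<^sub>1 (T2 n)"
  proof (rule less_of_square_bounds[OF ext_spectral_radius_T3_le[OF n D_def] _
        ext_spectral_radius_T2_ge[OF n D_def] nonneg(3)])
    show "(D - 1) * (D + 1 / D)\<^sup>2 + (D / 3 + 3 / D)\<^sup>2 + 1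
        < (D - 1) * (D + 1 / D)\<^sup>2 + (D / 2 + 2 / D)\<^sup>2"
      unfolding half using inv sq by argo
  qed

  moreover have "\<eta>\<^sub>1 (T2 n) < \<eta>\<^sub>1 (T1 n)"
  proof (rule less_of_square_bounds[OF ext_spectral_radius_T2_le[OF n] _
        ext_spectral_radius_T1_ge[OF n refl] nonneg(2)])
    define E where "E = real n - 2"
    have E: "10 \<le> E" using n by (simp add: E_def)
    have "(E - 1) * (E\<^sup>2 + 2) \<le> (E - 1) * (E + 1 / E)\<^sup>2"
      using square_sum_inverse_ge[of E 1] E by (intro mult_left_mono) auto
    moreover have "E\<^sup>2 / 4 + 2 \<le> (E / 2 + 2 / E)\<^sup>2"
      using square_sum_inverse_ge[of E 2] E by simp
    \<comment> \<open>Four times the difference of the sides is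
      \<open>(E - 10) * (9 * E + 74) + 628\<close>.\<close>
    moreover have "(E - 1) ^ 3 + 27 + 3 * E + 2 < (E - 1) * (E\<^sup>2 + 2) + (E\<^sup>2 / 4 + 2)"
      using mult_nonneg_nonneg[of "E - 10" "9 * E + 74"] E
      by (simp add: algebra_simps power2_eq_square power3_eq_cube)
    ultimately have "(E - 1) ^ 3 + 27 + 3 * E + 2 < (E - 1) * (E + 1 / E)\<^sup>2 + (E / 2 + 2 / E)\<^sup>2"
      by linarith
    then show "(real n - 3) ^ 3 + 27 + 3 * (real n - 2) + 2
        < (real n - 2 - 1) * (real n - 2 + 1 / (real n - 2))\<^sup>2
          + ((real n - 2) / 2 + 2 / (real n - 2))\<^sup>2"
      by (simp add: E_def)
  qed

  moreover have "\<eta>\<^sub>1 (T1 n) < \<eta>\<^sub>1 (star n)"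
  proof (rule less_of_square_bounds[OF ext_spectral_radius_T1_le[OF n] _
        ext_spectral_radius_star_ge[OF n refl] nonneg(1)])
    define E where "E = real n - 1"
    have E: "11 \<le> E" using n by (simp add: E_def)
    have "E * (E\<^sup>2 + 2) \<le> E * (E + 1 / E)\<^sup>2"
      using square_sum_inverse_ge[of E 1] E by (intro mult_left_mono) auto
    \<comment> \<open>The difference of the sides is
      \<open>(E - 11) * (3 * E + 29) + 313\<close>.\<close>
    moreover have "(E - 1) ^ 3 + 8 + 3 * (E - 1) + 2 < E * (E\<^sup>2 + 2)"
      using mult_nonneg_nonneg[of "E - 11" "3 * E + 29"] E
      by (simp add: algebra_simps power2_eq_square power3_eq_cube)
    ultimately have "(E - 1) ^ 3 + 8 + 3 * (E - 1) + 2 < E * (E + 1 / E)\<^sup>2" by linarith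
    then show "(real n - 2) ^ 3 + 8 + 3 * (real n - 2) + 2
        < (real n - 1) * (real n - 1 + 1 / (real n - 1))\<^sup>2"
      by (simp add: E_def)
  qed
  ultimately show ?thesis by blast
qed

end
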